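(* Let $\alpha>-1$, let $M:[0,1]\to(0,\infty)$ be a strictly positive function of class $C^2$ on $[0,1]$, and let $\mu(z)=M(|z|)(1-|z|^2)^{\alpha}$ for $z\in\mathbb{D}$. Then for every $1<p<\infty$ the weighted Bergman projection $\mathbf{B}_{\mu}$ is bounded from $L^p(\mu)$ to $A^p(\mu)$; that is, there is a constant $C>0$ such that for every $f\in L^p(\mu)$ one has $\mathbf{B}_{\mu}f\in A^p(\mu)$ and $\|\mathbf{B}_{\mu}f\|_{p,\mu}\le C\|f\|_{p,\mu}$.
   Context: $\mathbb{D}$ is the open unit disc in $\mathbb{C}$ and $dA$ is Lebesgue area measure. For $1<p<\infty$, $L^p(\mu)$ is the space of measurable functions $f:\mathbb{D}\to\mathbb{C}$ (modulo a.e. equality) with $\|f\|_{p,\mu}^p=\int_{\mathbb{D}}|f(z)|^p\mu(z)\,dA(z)<\infty$, and $A^p(\mu)$ is the subspace of holomorphic functions in $L^p(\mu)$. The weighted Bergman projection $\mathbf{B}_{\mu}$ is the orthogonal projection from the Hilbert space $L^2(\mu)$ (inner product $\langle f,g\rangle_\mu=\int_{\mathbb{D}}f\overline{g}\,\mu\,dA$) onto its closed subspace $A^2(\mu)$. It is the integral operator $$\mathbf{B}_{\mu}f(z)=\int_{\mathbb{D}}B_{\mu}(z,w)f(w)\mu(w)\,dA(w),\qquad B_{\mu}(z,w)=\sum_{n=0}^{\infty}b_n(z\bar w)^n,\qquad b_n=\frac{1}{\int_{\mathbb{D}}|z|^{2n}\mu(z)\,dA(z)},$$ and on $L^p(\mu)$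 the operator $\mathbf{B}_\mu$ is understood through this integral formula (for fixed $z\in\mathbb{D}$ the kernel $B_\mu(z,\cdot)$ is bounded on $\mathbb{D}$, so the integral converges absolutely for every $f\in L^p(\mu)$). *)

theory Defs
  imports "HOL-Complex_Analysis.Complex_Analysis"
begin

text \<open>
  Differentiability is taken relative to \<open>S\<close>, hence one-sided at the endpoints when \<open>S\<close> is a
  closed interval. Only the values of the function on \<open>S\<close> matter.
\<close>
definition C2_on :: "real set \<Rightarrow> (real \<Rightarrow> real) \<Rightarrow> bool" where
  "C2_on S g \<longleftrightarrow> (\<exists>g' g''.
     (\<forall>x\<in>S. (g has_real_derivative g' x) (at x within S)) \<and>
     (\<forall>x\<in>S. (g' has_real_derivative g'' x) (at x within S)) \<and>
     continuous_on S g'')"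

abbreviation disc :: "complex set" where
  "disc \<equiv> ball 0 1"

abbreviation area :: "complex measure" where
  "area \<equiv> lebesgue_on disc"

text \<open>
  Elements of \<open>Lp\<close> are functions rather than classes modulo a.e. equality; their values outside
  the disc are irrelevant. In particular \<open>Lp_norm\<close> is only a seminorm on functions.
\<close>
definition Lp :: "real \<Rightarrow> (complex \<Rightarrow> real) \<Rightarrow> (complex \<Rightarrow> complex) set" where
  "Lp p \<mu> = {f \<in> borel_measurable area. integrable area (\<lambda>z. norm (f z) powr p * \<mu> z)}"

definition Lp_norm :: "real \<Rightarrow> (complex \<Rightarrow> real) \<Rightarrow> (complex \<Rightarrow> complex) \<Rightarrow> real" where
  "Lp_norm p \<mu> f = (LINT z|area. norm (f z) powr p * \<mu> z) powr (1 / p)"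

definition Ap :: "real \<Rightarrow> (complex \<Rightarrow> real) \<Rightarrow> (complex \<Rightarrow> complex) set" where
  "Ap p \<mu> = {f \<in> Lp p \<mu>. f holomorphic_on disc}"

definition kernel_coeff :: "(complex \<Rightarrow> real) \<Rightarrow> nat \<Rightarrow> real" where
  "kernel_coeff \<mu> n = 1 / (LINT z|area. norm z ^ (2 * n) * \<mu> z)"

definition bergman_kernel :: "(complex \<Rightarrow> real) \<Rightarrow> complex \<Rightarrow> complex \<Rightarrow> complex" where
  "bergman_kernel \<mu> z w = (\<Sum>n. of_real (kernel_coeff \<mu> n) * (z * cnj w) ^ n)"

text \<open>
  For the radial weights considered here, this integral operator is on \<open>Lp 2 \<mu>\<close> the orthogonal
  projection onto \<open>Ap 2 \<mu>\<close>; on \<open>Lp p \<mu>\<close> the projection is understood through the integral.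
\<close>
definition bergman_projection ::
  "(complex \<Rightarrow> real) \<Rightarrow> (complex \<Rightarrow> complex) \<Rightarrow> complex \<Rightarrow> complex" where
  "bergman_projection \<mu> f z = (LINT w|area. bergman_kernel \<mu> z w * f w * of_real (\<mu> w))"

definition radial_weight :: "(real \<Rightarrow> real) \<Rightarrow> real \<Rightarrow> complex \<Rightarrow> real" where
  "radial_weight M \<alpha> z = M (norm z) * (1 - (norm z)\<^sup>2) powr \<alpha>"

end

theory Submission
  imports Defs
begin

text \<open>
  Since \<open>M\<close> is Lipschitz at \<open>1\<close>, comparison of the moments of \<open>\<mu>\<close> with Beta integrals shows that the
  kernel coefficients are \<open>c\<^sub>0 (\<alpha>+2)\<^sub>n / n!\<close> up to an error \<open>O((\<alpha>+1)\<^sub>n / n!)\<close>. Summing both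
  binomial series gives
  \<open>\<bar>B(z,w)\<bar> \<le> C (\<bar>1 - z cnj w\<bar> powr -(2+\<alpha>) + (1 - \<bar>z\<bar>\<bar>w\<bar>) powr -(1+\<alpha>))\<close>. The error term is bounded
  in absolute value only, but this loses nothing: averaging the first summand over rotations of \<open>w\<close>
  also yields \<open>(1 - \<bar>z\<bar>\<bar>w\<bar>) powr -(1+\<alpha>)\<close>. Boundedness then follows from the Schur test with the test
  function \<open>(1 - \<bar>z\<bar>\<^sup>2) powr -s\<close>, where \<open>s p\<close> and \<open>s q\<close> are smaller than \<open>\<alpha> + 1\<close>.
\<close>

text \<open>The range of s has a reason at each end. At s = 0 the integral of the second summand of
  the majorant would grow like log(1 / (1 - |z|)); s > 0 makes it reproduce the power -s exactly.
  The upper bounds keep the weight times the test function integrable up to the circle. Polar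
  coordinates are replaced by two separate facts: area is invariant under rotation, and w -> |w|^2
  carries area on the disc to pi times length on [0,1]. The squared radius absorbs the Jacobian, so
  moments are Beta integrals at once. The majorant is integrated in the extended nonnegative reals,
  so exchanging integrals requires no prior finiteness. The Schur test accepts any function
  dominated by a positive kernel operator; joint measurability is therefore checked for the explicit
  majorant, not for the kernel series.\<close>

text \<open>Cutting at v = d leaves a pure power on either side. The hypotheses on \<open>a\<close>
  and \<open>b\<close> are convergence at 0 and at infinity and give the two fractions in the
  constant. Here max d v plays the part of d + v; the bound serves both the angular integral (a = 0)
  and the radial one.\<close>

lemma nn_integral_powr_max:
  fixes a b d :: real
  assumes a: "a > -1" and ab: "a + 1 < b" and d: "d > 0"
  shows "(\<integral>\<^sup>+v\<in>{0..}. ennreal (v powr a * max d v powr (-b)) \<partial>lborel)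
      \<le> ennreal ((1 / (a + 1) + 1 / (b - a - 1)) * d powr (a + 1 - b))"
proof -
  have 1: "(\<integral>\<^sup>+v. ennreal (v powr a) * indicator {0..d} v \<partial>lborel) = ennreal (d powr (a + 1) / (a + 1))"
    by (rule nn_integral_has_integral_lebesgue') (use has_integral_powr_from_0[of a d] a d in auto)
  have 2: "(\<integral>\<^sup>+v. ennreal (v powr (a - b)) * indicator {d..} v \<partial>lborel)
      = ennreal (- (d powr (a - b + 1)) / (a - b + 1))"
    by (rule nn_integral_has_integral_lebesgue') (use has_integral_powr_to_inf[of "a - b" d] ab d in auto)
  have "(\<integral>\<^sup>+v\<in>{0..}. ennreal (v powr a * max d v powr (-b)) \<partial>lborel)
      \<le> (\<integral>\<^sup>+v. ennreal (d powr (-b)) * (ennreal (v powr a) * indicator {0..d} v)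
            + ennreal (v powr (a - b)) * indicator {d..} v \<partial>lborel)"
  proof (rule nn_integral_mono)
    fix v :: real
    have "v powr a * max d v powr (-b) = d powr (-b) * v powr a" if "v \<le> d"
      using that by (simp add: max_def)
    moreover have "v powr a * max d v powr (-b) = v powr (a - b)" if "v > d"
      using that d by (simp add: max_def powr_diff powr_minus divide_inverse)
    ultimately show "ennreal (v powr a * max d v powr (-b)) * indicator {0..} v
       \<le> ennreal (d powr (-b)) * (ennreal (v powr a) * indicator {0..d} v)
            + ennreal (v powr (a - b)) * indicator {d..} v"
      using d by (cases "v \<le> d") (auto split: split_indicator simp: ennreal_mult' mult.commute)
  qed
  also have "\<dots> = ennreal (d powr (-b)) * ennreal (d powr (a + 1) / (a + 1))
      + ennreal (- (d powr (a - b + 1)) / (a - b + 1))"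
    by (subst nn_integral_add; (subst nn_integral_cmult)?) (auto simp: 1 2)
  also have "\<dots> = ennreal (d powr (-b) * (d powr (a + 1) / (a + 1)) + - (d powr (a - b + 1)) / (a - b + 1))"
  proof -
    have "0 \<le> - (d powr (a - b + 1)) / (a - b + 1)"
      using ab by (intro divide_nonpos_neg) auto
    then show ?thesis
      using a ab by (subst ennreal_plus) (auto simp: ennreal_mult'[symmetric])
  qed
  also have "d powr (-b) * (d powr (a + 1) / (a + 1)) + - (d powr (a - b + 1)) / (a - b + 1)
     = (1 / (a + 1) + 1 / (b - a - 1)) * d powr (a + 1 - b)"
  proof -
    have *: "d powr (-b) * d powr (a + 1) = d powr (a + 1 - b)" "a - b + 1 = a + 1 - b"
      by (simp_all flip: powr_add)
    have "- (d powr (a - b + 1)) / (a - b + 1) = d powr (a + 1 - b) / (b - a - 1)"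
      using ab by (simp add: field_simps)
    then show ?thesis using * by (simp add: algebra_simps)
  qed
  finally show ?thesis .
qed

section \<open>Rotation invariance and radial integrals in the plane\<close>

lemma borel_measurable_Complex [measurable (raw)]:
  assumes [measurable]: "f \<in> borel_measurable M" "g \<in> borel_measurable M"
  shows "(\<lambda>x. Complex (f x) (g x)) \<in> borel_measurable M"
  unfolding Complex_eq by measurable

lemma borel_measurable_cnj [measurable]: "cnj \<in> borel_measurable borel"
  by (intro borel_measurable_continuous_onI continuous_intros)

lemma borel_measurable_cis [measurable]: "cis \<in> borel_measurable borel"
  by (intro borel_measurable_continuous_onI continuous_intros)

text \<open>Lebesgue measure is determined by its values on open boxes, and a complex box is a
  product of two intervals. This is what turns plane integrals into iterated ones.\<close>

lemma lborel_complex: "distr (lborel \<Otimes>\<^sub>M lborel) borel (\<lambda>(x, y). Complex x y) = lborel"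
proof (rule lborel_eqI[symmetric])
  have [measurable]: "(\<lambda>(x, y). Complex x y) \<in> borel_measurable (lborel \<Otimes>\<^sub>M lborel)"
    by measurable
  fix l u :: complex assume lu: "\<And>b. b \<in> Basis \<Longrightarrow> l \<bullet> b \<le> u \<bullet> b"
  have le: "Re l \<le> Re u" "Im l \<le> Im u"
    using lu[of 1] lu[of \<i>] by (auto simp: Basis_complex_def)
  have "(\<lambda>(x, y). Complex x y) -` box l u \<inter> space (lborel \<Otimes>\<^sub>M lborel)
      = {Re l<..<Re u} \<times> {Im l<..<Im u}"
    by (auto simp: in_box_complex_iff space_pair_measure)
  then have "emeasure (distr (lborel \<Otimes>\<^sub>M lborel) borel (\<lambda>(x, y). Complex x y)) (box l u)
     = emeasure (lborel \<Otimes>\<^sub>M lborel) ({Re l<..<Re u} \<times> {Im l<..<Im u})"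
    by (subst emeasure_distr) auto
  also have "\<dots> = ennreal (Re u - Re l) * ennreal (Im u - Im l)"
    using le by (subst lborel.emeasure_pair_measure_Times) auto
  finally show "emeasure (distr (lborel \<Otimes>\<^sub>M lborel) borel (\<lambda>(x, y). Complex x y)) (box l u)
     = (\<Prod>b\<in>Basis. (u - l) \<bullet> b)"
    using le by (simp add: Basis_complex_def ennreal_mult')
qed auto

lemma
  fixes f :: "complex \<Rightarrow> ennreal"
  assumes [measurable]: "f \<in> borel_measurable borel"
  shows nn_integral_complex_Re_Im:
      "(\<integral>\<^sup>+w. f w \<partial>lborel) = (\<integral>\<^sup>+x. (\<integral>\<^sup>+y. f (Complex x y) \<partial>lborel) \<partial>lborel)"
    and nn_integral_complex_Im_Re:
      "(\<integral>\<^sup>+w. f w \<partial>lborel) = (\<integral>\<^sup>+y. (\<integral>\<^sup>+x. f (Complex x y) \<partial>lborel) \<partial>lborel)"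
proof -
  have [measurable]: "(\<lambda>(x, y). Complex x y) \<in> borel_measurable (lborel \<Otimes>\<^sub>M lborel)"
    by measurable
  have "(\<integral>\<^sup>+w. f w \<partial>lborel) = (\<integral>\<^sup>+p. f (case p of (x, y) \<Rightarrow> Complex x y) \<partial>(lborel \<Otimes>\<^sub>M lborel))"
    by (subst lborel_complex[symmetric]) (simp add: nn_integral_distr)
  moreover have "(\<lambda>p. f (case p of (x, y) \<Rightarrow> Complex x y)) \<in> borel_measurable (lborel \<Otimes>\<^sub>M lborel)"
    by measurable
  ultimately show "(\<integral>\<^sup>+w. f w \<partial>lborel) = (\<integral>\<^sup>+x. (\<integral>\<^sup>+y. f (Complex x y) \<partial>lborel) \<partial>lborel)"
      "(\<integral>\<^sup>+w. f w \<partial>lborel) = (\<integral>\<^sup>+y. (\<integral>\<^sup>+x. f (Complex x y) \<partial>lborel) \<partial>lborel)"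
    by (simp add: lborel.nn_integral_fst[symmetric], simp add: lborel_pair.nn_integral_snd[symmetric])
qed

text \<open>A shear moves one coordinate by an amount depending on the other. With the moving
  coordinate as inner variable it is a translation of the line, which is why both orders of
  integration are at hand.\<close>

lemma nn_integral_lborel_shear:
  fixes f :: "complex \<Rightarrow> ennreal"
  assumes [measurable]: "f \<in> borel_measurable borel"
  shows "(\<integral>\<^sup>+w. f (Complex (Re w + a * Im w) (Im w)) \<partial>lborel) = (\<integral>\<^sup>+w. f w \<partial>lborel)"
    and "(\<integral>\<^sup>+w. f (Complex (Re w) (Im w + a * Re w)) \<partial>lborel) = (\<integral>\<^sup>+w. f w \<partial>lborel)"
proof -
  have "(\<integral>\<^sup>+x. f (Complex (x + a * y) y) \<partial>lborel) = (\<integral>\<^sup>+x. f (Complex x y) \<partial>lborel)" for y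
    using nn_integral_real_affine[of "\<lambda>x. f (Complex x y)" 1 "a * y"] by (simp add: add_ac)
  then show "(\<integral>\<^sup>+w. f (Complex (Re w + a * Im w) (Im w)) \<partial>lborel) = (\<integral>\<^sup>+w. f w \<partial>lborel)"
    by (simp add: nn_integral_complex_Im_Re)
  have "(\<integral>\<^sup>+y. f (Complex x (y + a * x)) \<partial>lborel) = (\<integral>\<^sup>+y. f (Complex x y) \<partial>lborel)" for x
    using nn_integral_real_affine[of "\<lambda>y. f (Complex x y)" 1 "a * x"] by (simp add: add_ac)
  then show "(\<integral>\<^sup>+w. f (Complex (Re w) (Im w + a * Re w)) \<partial>lborel) = (\<integral>\<^sup>+w. f w \<partial>lborel)"
    by (simp add: nn_integral_complex_Re_Im)
qed

text \<open>A rotation other than \<open>-1\<close> is a product of three shears.\<close>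
lemma nn_integral_lborel_rotate:
  fixes f :: "complex \<Rightarrow> ennreal"
  assumes [measurable]: "f \<in> borel_measurable borel" and c: "norm c = 1"
  shows "(\<integral>\<^sup>+w. f (c * w) \<partial>lborel) = (\<integral>\<^sup>+w. f w \<partial>lborel)"
proof -
  have rot: "(\<integral>\<^sup>+w. f (c * w) \<partial>lborel) = (\<integral>\<^sup>+w. f w \<partial>lborel)"
    if [measurable]: "f \<in> borel_measurable borel" and c: "norm c = 1" "c \<noteq> -1"
    for f :: "complex \<Rightarrow> ennreal" and c
  proof -
    have n: "(Re c)\<^sup>2 + (Im c)\<^sup>2 = 1" using c(1) by (simp add: cmod_def)
    have "1 + Re c \<noteq> 0"
    proof
      assume "1 + Re c = 0"
      then have "Re c = -1" by simp
      with n c(2) show False by (simp add: complex_eq_iff)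
    qed
    \<comment> \<open>For c = cis t these are b = sin t and a = -tan (t/2), the classical shear
      parameters; the denominator vanishes only at c = -1.\<close>
    define b a where "b = Im c" and "a = - Im c / (1 + Re c)"
    have ab: "1 + a * b = Re c" "a * (1 + Re c) = - Im c"
      using \<open>1 + Re c \<noteq> 0\<close> n unfolding a_def b_def by (simp_all add: field_simps power2_eq_square)
    have "(\<integral>\<^sup>+w. f w \<partial>lborel) = (\<integral>\<^sup>+w. f (Complex (Re w + a * Im w) (Im w)) \<partial>lborel)"
      by (rule nn_integral_lborel_shear[symmetric]) measurable
    also have "\<dots> = (\<integral>\<^sup>+w. f (Complex (Re w + a * (Im w + b * Re w)) (Im w + b * Re w)) \<partial>lborel)"
      using nn_integral_lborel_shear(2)[of "\<lambda>w. f (Complex (Re w + a * Im w) (Im w))" b] by simp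
    also have "\<dots> = (\<integral>\<^sup>+w. f (Complex (Re w + a * Im w + a * (Im w + b * (Re w + a * Im w)))
          (Im w + b * (Re w + a * Im w))) \<partial>lborel)"
      using nn_integral_lborel_shear(1)[of
          "\<lambda>w. f (Complex (Re w + a * (Im w + b * Re w)) (Im w + b * Re w))" a] by simp
    also have "\<dots> = (\<integral>\<^sup>+w. f (c * w) \<partial>lborel)"
    proof (intro nn_integral_cong arg_cong[where f = f] complex_eqI)
      fix w
      have "Re w + a * Im w + a * (Im w + b * (Re w + a * Im w))
          = (1 + a * b) * Re w + a * (1 + (1 + a * b)) * Im w" by (simp add: algebra_simps)
      then show "Re (Complex (Re w + a * Im w + a * (Im w + b * (Re w + a * Im w)))
          (Im w + b * (Re w + a * Im w))) = Re (c * w)"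
        unfolding ab by simp
      have "Im w + b * (Re w + a * Im w) = (1 + a * b) * Im w + b * Re w" by (simp add: algebra_simps)
      then show "Im (Complex (Re w + a * Im w + a * (Im w + b * (Re w + a * Im w)))
          (Im w + b * (Re w + a * Im w))) = Im (c * w)"
        unfolding ab by (simp add: b_def)
    qed
    finally show ?thesis ..
  qed
  show ?thesis
  proof (cases "c = -1")
    \<comment> \<open>The excluded half turn is a product of two quarter turns, each covered by
      \<open>rot\<close>.\<close>
    case True
    have "(\<integral>\<^sup>+w. f (c * w) \<partial>lborel) = (\<integral>\<^sup>+w. f (\<i> * (\<i> * w)) \<partial>lborel)"
      by (simp add: True flip: mult.assoc)
    also have "\<dots> = (\<integral>\<^sup>+w. f (\<i> * w) \<partial>lborel)"
      by (rule rot[of "\<lambda>w. f (\<i> * w)" \<i>]) (auto simp: complex_eq_iff)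
    also have "\<dots> = (\<integral>\<^sup>+w. f w \<partial>lborel)"
      by (rule rot) (auto simp: complex_eq_iff)
    finally show ?thesis .
  qed (use rot c in auto)
qed


section \<open>Angular integrals of powers of |1 - \<zeta> cis t|\<close>

text \<open>The sine bound gives |1 - cis v| \<ge> |v| / 3. Passing from cis v to r cis v costs 1 -
  r, which is itself at most |1 - r cis v|; hence half of the bound survives, and the constant is
  6.\<close>

lemma norm_one_minus_cis_ge:
  fixes r v :: real
  assumes r: "0 \<le> r" "r < 1" and v: "\<bar>v\<bar> \<le> pi"
  shows "max (1 - r) \<bar>v\<bar> / 6 \<le> norm (1 - of_real r * cis v)"
proof -
  define x where "x = \<bar>v\<bar> / 2"
  have x: "0 \<le> x" "x \<le> 2" using v pi_less_4 by (auto simp: x_def)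
  \<comment> \<open>On x \<le> 2 the Taylor remainder x^3 / 6 is at most 2 x / 3, leaving x / 3 for
    the sine.\<close>
  have "x * (x * x) \<le> x * (2 * 2)" using x by (intro mult_mono) auto
  moreover have "\<bar>sin x - x\<bar> \<le> x ^ 3 / 6"
    using Maclaurin_sin_bound[of x 3] x
    by (simp add: numeral_3_eq_3 sin_coeff_def field_simps fact_numeral)
  ultimately have "x / 3 \<le> sin x" by (simp add: power3_eq_cube abs_if split: if_splits)
  then have "\<bar>v\<bar> / 6 \<le> \<bar>sin (v / 2)\<bar>"
    unfolding x_def by (cases "v \<ge> 0") auto
  moreover have "norm (1 - cis v) = 2 * \<bar>sin (v / 2)\<bar>"
    using dist_exp_i_1[of v] by (simp add: cis_conv_exp norm_minus_commute)
  moreover have "norm (1 - cis v) \<le> norm (1 - of_real r * cis v) + norm (of_real r * cis v - cis v)"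
    using norm_triangle_ineq[of "1 - of_real r * cis v" "of_real r * cis v - cis v"] by simp
  moreover have "norm (of_real r * cis v - cis v) = 1 - r"
  proof -
    have "of_real r * cis v - cis v = of_real (r - 1) * cis v" by (simp add: algebra_simps)
    then show ?thesis using r by (simp add: norm_mult del: of_real_diff)
  qed
  moreover have "1 - r \<le> norm (1 - of_real r * cis v)"
    using norm_triangle_ineq2[of 1 "of_real r * cis v"] r by (simp add: norm_mult)
  ultimately show ?thesis using r by auto
qed

text \<open>Up to the factor \<open>6 powr b\<close> the integrand is at most \<open>h\<close>,
  evaluated at the angle reduced to [-pi, pi]. The other factor 6 counts three translates of
  \<open>h\<close> with two half-lines each.\<close>

lemma nn_integral_angular:
  fixes b :: real and \<zeta> :: complex
  assumes b: "b > 1" and z: "norm \<zeta> < 1"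
  shows "(\<integral>\<^sup>+t\<in>{-pi..pi}. ennreal (norm (1 - \<zeta> * cis t) powr (-b)) \<partial>lborel)
      \<le> ennreal (6 * 6 powr b * (1 + 1 / (b - 1)) * (1 - norm \<zeta>) powr (1 - b))"
proof -
  define d where "d = 1 - norm \<zeta>"
  define K where "K = (1 + 1 / (b - 1)) * d powr (1 - b)"
  define h where "h v = ennreal (max d \<bar>v\<bar> powr (-b))" for v :: real
  have h_meas [measurable]: "h \<in> borel_measurable borel" unfolding h_def by measurable
  have d: "d > 0" using z by (simp add: d_def)
  have K0: "K \<ge> 0" using b by (simp add: K_def)
  have half: "(\<integral>\<^sup>+v. h v * indicator {0..} v \<partial>lborel) \<le> ennreal K"
  proof -
    have "(\<integral>\<^sup>+v. h v * indicator {0..} v \<partial>lborel)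
        \<le> (\<integral>\<^sup>+v\<in>{0..}. ennreal (v powr 0 * max d v powr (-b)) \<partial>lborel)"
      \<comment> \<open>The point 0 is discarded because \<open>0 powr 0\<close> is 0.\<close>
      by (rule nn_integral_mono_AE, use AE_lborel_singleton[of 0] in eventually_elim)
        (auto simp: h_def split: split_indicator)
    also have "\<dots> \<le> ennreal K"
      using nn_integral_powr_max[of 0 b d] b d by (simp add: K_def)
    finally show ?thesis .
  qed
  have full: "(\<integral>\<^sup>+v. h v \<partial>lborel) \<le> ennreal (2 * K)"
  proof -
    have "(\<integral>\<^sup>+v. h v \<partial>lborel) \<le> (\<integral>\<^sup>+v. h v * indicator {0..} v + h (-v) * indicator {0..} (-v) \<partial>lborel)"
      by (rule nn_integral_mono) (auto simp: h_def split: split_indicator)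
    also have "\<dots> = (\<integral>\<^sup>+v. h v * indicator {0..} v \<partial>lborel) + (\<integral>\<^sup>+v. h (-v) * indicator {0..} (-v) \<partial>lborel)"
      by (rule nn_integral_add) measurable
    also have "(\<integral>\<^sup>+v. h (-v) * indicator {0..} (-v) \<partial>lborel) = (\<integral>\<^sup>+v. h v * indicator {0..} v \<partial>lborel)"
      using nn_integral_real_affine[of "\<lambda>v. h v * indicator {0..} v" "-1" 0] by simp
    also have "(\<integral>\<^sup>+v. h v * indicator {0..} v \<partial>lborel) + (\<integral>\<^sup>+v. h v * indicator {0..} v \<partial>lborel)
        \<le> ennreal K + ennreal K" by (intro add_mono half)
    finally show ?thesis using K0 by (simp flip: ennreal_plus)
  qed
  have shift: "(\<integral>\<^sup>+t. h (t + c) \<partial>lborel) = (\<integral>\<^sup>+v. h v \<partial>lborel)" for c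
    using nn_integral_real_affine[of h 1 c] by (simp add: add.commute)
  define p where "p = Arg \<zeta>"
  have p: "\<bar>p\<bar> \<le> pi" using Arg_bounded[of \<zeta>] by (simp add: p_def abs_le_iff)
  have pt: "ennreal (norm (1 - \<zeta> * cis t) powr (-b))
      \<le> ennreal (6 powr b) * (h (t + p) + h (t + (p - 2 * pi)) + h (t + (p + 2 * pi)))"
    if t: "t \<in> {-pi..pi}" for t
  proof -
    have eq: "\<zeta> * cis t = of_real (norm \<zeta>) * cis (t + p)"
      using rcis_cmod_Arg[of \<zeta>] by (metis p_def rcis_def cis_mult mult.assoc add.commute)
    \<comment> \<open>Since t + p lies in [-2 pi, 2 pi], one shift by 0 or by plus or minus 2 pi
      returns it to [-pi, pi]. Which one depends on t, so the bound adds all three.\<close>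
    obtain u where u: "u \<in> {t + p, t + (p - 2 * pi), t + (p + 2 * pi)}" "\<bar>u\<bar> \<le> pi"
    proof (cases "t + p > pi")
      case True then show ?thesis using that[of "t + (p - 2 * pi)"] t p by auto
    next
      case False
      show ?thesis
      proof (cases "t + p < - pi")
        case True then show ?thesis using that[of "t + (p + 2 * pi)"] t p by auto
      next
        case False with \<open>\<not> t + p > pi\<close> show ?thesis using that[of "t + p"] by auto
      qed
    qed
    have "cis u = cis (t + p)"
      using u(1) by (auto simp: complex_eq_iff sin_add cos_add sin_diff cos_diff)
    then have "max d \<bar>u\<bar> / 6 \<le> norm (1 - \<zeta> * cis t)"
      using norm_one_minus_cis_ge[of "norm \<zeta>" u] z u(2) eq by (simp add: d_def)
    then have "norm (1 - \<zeta> * cis t) powr (-b) \<le> (max d \<bar>u\<bar> / 6) powr (-b)"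
      using d b by (intro powr_mono2') auto
    also have "\<dots> = 6 powr b * max d \<bar>u\<bar> powr (-b)"
      using d by (simp add: powr_divide powr_minus field_simps)
    finally have "ennreal (norm (1 - \<zeta> * cis t) powr (-b)) \<le> ennreal (6 powr b) * h u"
      by (simp add: h_def flip: ennreal_mult')
    also have "h u \<le> h (t + p) + h (t + (p - 2 * pi)) + h (t + (p + 2 * pi))"
      using u(1) by (auto simp: add_increasing add_increasing2)
    finally show ?thesis by (simp add: mult_left_mono)
  qed
  have "(\<integral>\<^sup>+t\<in>{-pi..pi}. ennreal (norm (1 - \<zeta> * cis t) powr (-b)) \<partial>lborel)
     \<le> (\<integral>\<^sup>+t. ennreal (6 powr b) * (h (t + p) + h (t + (p - 2 * pi)) + h (t + (p + 2 * pi))) \<partial>lborel)"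
    by (rule nn_integral_mono) (use pt in \<open>auto split: split_indicator\<close>)
  also have "\<dots> = ennreal (6 powr b) * ((\<integral>\<^sup>+v. h v \<partial>lborel) + (\<integral>\<^sup>+v. h v \<partial>lborel) + (\<integral>\<^sup>+v. h v \<partial>lborel))"
    by (simp add: nn_integral_cmult nn_integral_add shift)
  also have "\<dots> \<le> ennreal (6 powr b) * (ennreal (2 * K) + ennreal (2 * K) + ennreal (2 * K))"
    by (intro mult_left_mono add_mono full) auto
  also have "\<dots> = ennreal (6 * 6 powr b * K)"
    using K0 by (simp flip: ennreal_plus ennreal_mult' add: algebra_simps)
  finally show ?thesis by (simp add: K_def d_def mult.assoc)
qed

section \<open>Area integrals of functions of the modulus\<close>

text \<open>The part of the disc where |w|^2 > x has area pi (1 - x) for x in [0,1]. So the image of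
  area under the squared modulus agrees on all rays with pi times length on [0,1], and finite
  measures agreeing on rays are equal.\<close>

lemma nn_integral_disc_radial:
  fixes f :: "real \<Rightarrow> ennreal"
  assumes [measurable]: "f \<in> borel_measurable borel"
  shows "(\<integral>\<^sup>+w\<in>ball (0::complex) 1. f ((norm w)\<^sup>2) \<partial>lborel) = ennreal pi * (\<integral>\<^sup>+t\<in>{0..1}. f t \<partial>lborel)"
proof -
  let ?B = "ball (0::complex) 1"
  define M where "M = distr (density lborel (indicator ?B)) borel (\<lambda>w. (norm w)\<^sup>2)"
  define N where "N = density lborel (\<lambda>t. ennreal pi * indicator {0..1::real} t)"
  have M: "emeasure M {x<..} = emeasure lborel (?B \<inter> {w. (norm w)\<^sup>2 > x})" for x
  proof -
    have "{w::complex. (norm w)\<^sup>2 > x} \<in> sets borel" by measurable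
    then show ?thesis
      unfolding M_def by (subst emeasure_distr) (simp_all add: emeasure_restricted vimage_def)
  qed
  have N: "emeasure N {x<..} = ennreal pi * emeasure lborel ({0..1} \<inter> {x<..})" for x
    unfolding N_def by (simp add: emeasure_density nn_integral_cmult mult.assoc
            indicator_inter_arith[symmetric] del: atLeastAtMost_iff)
  have eq: "emeasure M {x<..} = emeasure N {x<..}" for x
  proof -
    consider "x < 0" | "0 \<le> x" "x < 1" | "1 \<le> x" by linarith
    then show ?thesis
    proof cases
      case 1
      have "?B \<inter> {w. (norm w)\<^sup>2 > x} = ?B"
        using 1 by (auto intro: less_le_trans)
      moreover have "{0..1} \<inter> {x<..} = {0..1}" using 1 by auto
      ultimately show ?thesis unfolding M N by (simp add: emeasure_ball unit_ball_vol_2)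
    next
      case 2
      have "x < (norm w)\<^sup>2 \<longleftrightarrow> sqrt x < norm w" for w :: complex
        using real_sqrt_less_iff[of x "(norm w)\<^sup>2"] by simp
      then have "?B \<inter> {w. (norm w)\<^sup>2 > x} = ?B - cball 0 (sqrt x)"
        by (simp add: set_eq_iff not_le)
      moreover have "emeasure lborel (?B - cball 0 (sqrt x)) = ennreal (pi - pi * x)"
      proof -
        have "sqrt x < 1" using 2 by simp
        then have "cball 0 (sqrt x) \<subseteq> ?B" by (auto simp del: real_sqrt_lt_1_iff)
        then have "emeasure lborel (?B - cball 0 (sqrt x))
            = emeasure lborel ?B - emeasure lborel (cball (0::complex) (sqrt x))"
          using 2 by (intro emeasure_Diff) (simp_all add: emeasure_cball)
        then show ?thesis
          using 2 by (simp add: emeasure_ball emeasure_cball unit_ball_vol_2 ennreal_minus)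
      qed
      moreover have "{0..1} \<inter> {x<..} = {x<..1}" using 2 by auto
      ultimately show ?thesis unfolding M N using 2
        by (simp add: algebra_simps flip: ennreal_mult')
    next
      case 3
      have "?B \<inter> {w. (norm w)\<^sup>2 > x} = {}"
        using 3 by (auto simp: not_less) (smt (verit) norm_ge_zero power_le_one)
      moreover have "{0..1} \<inter> {x<..} = {}" using 3 by auto
      ultimately show ?thesis unfolding M N by simp
    qed
  qed
  have "M = N"
  proof (rule measure_eqI_lessThan)
    fix x
    have "emeasure N {x<..} \<le> ennreal pi * emeasure lborel {0..1::real}"
      unfolding N by (intro mult_left_mono emeasure_mono) auto
    also have "\<dots> < \<infinity>" by simp
    finally show "emeasure M {x<..} < \<infinity>" unfolding eq .
    show "emeasure M {x<..} = emeasure N {x<..}" by (rule eq)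
  qed (simp_all add: M_def N_def)
  have "(\<integral>\<^sup>+w\<in>?B. f ((norm w)\<^sup>2) \<partial>lborel) = (\<integral>\<^sup>+w. f ((norm w)\<^sup>2) \<partial>density lborel (indicator ?B))"
    by (subst nn_integral_density) (simp_all add: mult.commute borel_measurable_indicator)
  also have "\<dots> = (\<integral>\<^sup>+t. f t \<partial>N)"
    unfolding \<open>M = N\<close>[symmetric] M_def by (subst nn_integral_distr) simp_all
  also have "\<dots> = ennreal pi * (\<integral>\<^sup>+t\<in>{0..1}. f t \<partial>lborel)"
    unfolding N_def by (simp add: nn_integral_density nn_integral_cmult mult.assoc mult.commute[of "f _"])
  finally show ?thesis .
qed

section \<open>Integral estimates for the kernel majorant\<close>

lemma disc_measurable [measurable]: "Measurable.pred borel (\<lambda>w. w \<in> disc)"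
  by (rule pred_sets2[where f = "\<lambda>x. x" and N = borel]) simp_all

text \<open>Rotating w leaves \<open>F (norm w)\<close> and the disc unchanged, so the integral may
  be averaged over rotations; after exchanging the integrals only the second factor is integrated in
  the angle. This gains one power of 1 - |z||w|.\<close>

lemma nn_integral_disc_angular:
  fixes F :: "real \<Rightarrow> ennreal" and b :: real and z :: complex
  assumes F [measurable]: "F \<in> borel_measurable borel" and b: "b > 1" and z: "norm z < 1"
  shows "(\<integral>\<^sup>+w\<in>disc. F (norm w) * ennreal (norm (1 - z * cnj w) powr (-b)) \<partial>lborel)
    \<le> ennreal (6 * 6 powr b * (1 + 1 / (b - 1)))
        * (\<integral>\<^sup>+w\<in>disc. F (norm w) * ennreal ((1 - norm z * norm w) powr (1 - b)) \<partial>lborel)"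
    (is "?L \<le> ennreal ?C * ?R")
proof -
  define G where "G w = F (norm w) * ennreal (norm (1 - z * cnj w) powr (-b)) * indicator disc w" for w
  have G [measurable]: "G \<in> borel_measurable borel" unfolding G_def by measurable
  have "?L = (\<integral>\<^sup>+w. G w \<partial>lborel)" by (simp add: G_def)
  \<comment> \<open>The factor 2 pi \<ge> 1 is the length of the range of angles; inserting it
    rather than normalising the average only enlarges the bound.\<close>
  also have "\<dots> \<le> (\<integral>\<^sup>+w. G w \<partial>lborel) * ennreal (2 * pi)"
    using mult_left_mono[of 1 "ennreal (2 * pi)" "\<integral>\<^sup>+w. G w \<partial>lborel"] pi_gt3 by simp
  also have "\<dots> = (\<integral>\<^sup>+t. (\<integral>\<^sup>+w. G w \<partial>lborel) * indicator {-pi..pi} t \<partial>lborel)"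
    by (simp add: nn_integral_cmult)
  also have "\<dots> = (\<integral>\<^sup>+t. (\<integral>\<^sup>+w. G (cis (-t) * w) * indicator {-pi..pi} t \<partial>lborel) \<partial>lborel)"
    by (intro nn_integral_cong) (simp add: nn_integral_multc nn_integral_lborel_rotate)
  also have "\<dots> = (\<integral>\<^sup>+w. (\<integral>\<^sup>+t. G (cis (-t) * w) * indicator {-pi..pi} t \<partial>lborel) \<partial>lborel)"
    by (rule lborel_pair.Fubini') measurable
  also have "\<dots> \<le> (\<integral>\<^sup>+w. ennreal ?C * (F (norm w) * ennreal ((1 - norm z * norm w) powr (1 - b)) * indicator disc w) \<partial>lborel)"
  proof (rule nn_integral_mono)
    fix w
    show "(\<integral>\<^sup>+t. G (cis (-t) * w) * indicator {-pi..pi} t \<partial>lborel)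
        \<le> ennreal ?C * (F (norm w) * ennreal ((1 - norm z * norm w) powr (1 - b)) * indicator disc w)"
    proof (cases "w \<in> disc")
      case True
      then have "norm z * norm w < 1" using z mult_strict_mono'[of "norm z" 1 "norm w" 1] by auto
      have "(\<integral>\<^sup>+t. G (cis (-t) * w) * indicator {-pi..pi} t \<partial>lborel)
          = (\<integral>\<^sup>+t. F (norm w) * (ennreal (norm (1 - (z * cnj w) * cis t) powr (-b)) * indicator {-pi..pi} t) \<partial>lborel)"
        using True by (intro nn_integral_cong) (simp add: G_def norm_mult cis_cnj mult_ac)
      also have "\<dots> = F (norm w) * (\<integral>\<^sup>+t\<in>{-pi..pi}. ennreal (norm (1 - (z * cnj w) * cis t) powr (-b)) \<partial>lborel)"
        by (rule nn_integral_cmult) measurable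
      also have "\<dots> \<le> F (norm w) * ennreal (?C * (1 - norm (z * cnj w)) powr (1 - b))"
        using nn_integral_angular[OF b, of "z * cnj w"] \<open>norm z * norm w < 1\<close>
        by (intro mult_left_mono) (simp_all add: norm_mult)
      also have "\<dots> = ennreal ?C * (F (norm w) * ennreal ((1 - norm z * norm w) powr (1 - b)) * indicator disc w)"
        using b True by (simp add: norm_mult ennreal_mult' mult_ac)
      finally show ?thesis .
    qed (simp add: G_def norm_mult)
  qed
  also have "\<dots> = ennreal ?C * ?R" by (rule nn_integral_cmult) measurable
  finally show ?thesis .
qed

text \<open>With s = |z||w| one has 1 - s \<ge> (1 - s^2) / 2, and s^2 is at most |z|^2 and |w|^2.
  Hence 1 - s is at least half of max (1 - |z|^2) (1 - |w|^2), and v = 1 - |w|^2 reduces the claim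
  to a one-dimensional integral.\<close>

lemma nn_integral_disc_powr:
  fixes a c :: real and z :: complex
  assumes a: "a > -1" and c: "a + 1 < c" and z: "norm z < 1"
  shows "(\<integral>\<^sup>+w\<in>disc. ennreal ((1 - (norm w)\<^sup>2) powr a * (1 - norm z * norm w) powr (-c)) \<partial>lborel)
    \<le> ennreal (pi * 2 powr c * (1 / (a + 1) + 1 / (c - a - 1)) * (1 - (norm z)\<^sup>2) powr (a + 1 - c))"
proof -
  define d where "d = 1 - (norm z)\<^sup>2"
  define K where "K = (1 / (a + 1) + 1 / (c - a - 1)) * d powr (a + 1 - c)"
  define f where "f v = ennreal (2 powr c) * ennreal (v powr a * max d v powr (-c))" for v :: real
  have [measurable]: "f \<in> borel_measurable borel" unfolding f_def by measurable
  have d: "d > 0" using z by (simp add: d_def power_less_one_iff abs_square_less_1)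
  have K: "K \<ge> 0" using a c by (simp add: K_def)
  have "(\<integral>\<^sup>+w\<in>disc. ennreal ((1 - (norm w)\<^sup>2) powr a * (1 - norm z * norm w) powr (-c)) \<partial>lborel)
      \<le> (\<integral>\<^sup>+w\<in>disc. f (1 - (norm w)\<^sup>2) \<partial>lborel)"
  proof (rule nn_integral_mono)
    fix w :: complex
    have "ennreal ((1 - (norm w)\<^sup>2) powr a * (1 - norm z * norm w) powr (-c)) \<le> f (1 - (norm w)\<^sup>2)"
      if w: "norm w < 1"
    proof -
      define s where "s = norm z * norm w"
      have s: "0 \<le> s" "s < 1" using z w mult_strict_mono'[of "norm z" 1 "norm w" 1] by (auto simp: s_def)
      have "(norm z)\<^sup>2 \<le> 1" "(norm w)\<^sup>2 \<le> 1" using z w by (simp_all add: power_le_one)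
      then have "s\<^sup>2 \<le> (norm z)\<^sup>2" "s\<^sup>2 \<le> (norm w)\<^sup>2"
        by (simp_all add: s_def power_mult_distrib mult_left_le mult_left_le_one_le)
      moreover have "1 - s\<^sup>2 \<le> 2 * (1 - s)"
        using zero_le_power2[of "1 - s"] by (simp add: power2_diff)
      ultimately have "max d (1 - (norm w)\<^sup>2) / 2 \<le> 1 - s" by (simp add: d_def)
      then have "(1 - s) powr (-c) \<le> (max d (1 - (norm w)\<^sup>2) / 2) powr (-c)"
        using d a c by (intro powr_mono2') auto
      also have "\<dots> = 2 powr c * max d (1 - (norm w)\<^sup>2) powr (-c)"
        using d by (simp add: powr_divide powr_minus field_simps)
      finally have "(1 - (norm w)\<^sup>2) powr a * (1 - s) powr (-c)
        \<le> (1 - (norm w)\<^sup>2) powr a * (2 powr c * max d (1 - (norm w)\<^sup>2) powr (-c))"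
        by (rule mult_left_mono) simp
      then show ?thesis
        unfolding f_def s_def by (subst ennreal_mult'[symmetric]) (auto intro!: ennreal_leI simp: mult_ac)
    qed
    then show "ennreal ((1 - (norm w)\<^sup>2) powr a * (1 - norm z * norm w) powr (-c)) * indicator disc w
        \<le> f (1 - (norm w)\<^sup>2) * indicator disc w"
      by (auto split: split_indicator)
  qed
  also have "\<dots> = ennreal pi * (\<integral>\<^sup>+t\<in>{0..1}. f (1 - t) \<partial>lborel)"
    by (rule nn_integral_disc_radial) measurable
  also have "(\<integral>\<^sup>+t\<in>{0..1}. f (1 - t) \<partial>lborel) = (\<integral>\<^sup>+v. f v * indicator {0..1} (1 - v) \<partial>lborel)"
    using nn_integral_real_affine[of "\<lambda>t. f (1 - t) * indicator {0..1} t" "-1" 1] by simp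
  also have "\<dots> \<le> (\<integral>\<^sup>+v. ennreal (2 powr c) * (ennreal (v powr a * max d v powr (-c)) * indicator {0..} v) \<partial>lborel)"
    by (rule nn_integral_mono) (auto simp: f_def split: split_indicator)
  also have "\<dots> = ennreal (2 powr c) * (\<integral>\<^sup>+v\<in>{0..}. ennreal (v powr a * max d v powr (-c)) \<partial>lborel)"
    by (rule nn_integral_cmult) measurable
  also have "\<dots> \<le> ennreal (2 powr c) * ennreal K"
    using nn_integral_powr_max[OF a c d] by (intro mult_left_mono) (auto simp: K_def)
  also have "ennreal pi * (ennreal (2 powr c) * ennreal K) = ennreal (pi * 2 powr c * K)"
    using K by (simp add: ennreal_mult mult.assoc)
  finally show ?thesis by (simp add: K_def d_def mult.assoc mult_left_mono)
qed

definition kernel_majorant :: "real \<Rightarrow> complex \<Rightarrow> complex \<Rightarrow> real" where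
  "kernel_majorant \<alpha> z w = norm (1 - z * cnj w) powr (-(2 + \<alpha>)) + (1 - norm z * norm w) powr (-(1 + \<alpha>))"

text \<open>After angular averaging both summands lead to the same radial integral, with a =
  \<alpha> - s and c = 1 + \<alpha>. Then a > -1 means s < \<alpha> + 1, a + 1 < c means s > 0, and
  the resulting exponent a + 1 - c is -s.\<close>

lemma nn_integral_kernel_majorant:
  fixes \<alpha> s :: real
  assumes \<alpha>: "\<alpha> > -1" and s: "0 < s" "s < \<alpha> + 1"
  obtains C where "C > 0" and "\<And>z. norm z < 1 \<Longrightarrow>
    (\<integral>\<^sup>+w\<in>disc. ennreal ((1 - (norm w)\<^sup>2) powr (\<alpha> - s) * kernel_majorant \<alpha> z w) \<partial>lborel)
      \<le> ennreal (C * (1 - (norm z)\<^sup>2) powr (-s))"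
proof -
  define C1 where "C1 = 6 * 6 powr (2 + \<alpha>) * (1 + 1 / (2 + \<alpha> - 1))"
  define C2 where "C2 = pi * 2 powr (1 + \<alpha>) * (1 / (\<alpha> - s + 1) + 1 / (1 + \<alpha> - (\<alpha> - s) - 1))"
  have C: "C1 > 0" "C2 > 0" using \<alpha> s by (auto simp: C1_def C2_def intro!: mult_pos_pos add_pos_pos)
  show thesis
  proof (rule that[of "(C1 + 1) * C2"])
    fix z :: complex assume z: "norm z < 1"
    define R where "R = (\<integral>\<^sup>+w\<in>disc. ennreal ((1 - (norm w)\<^sup>2) powr (\<alpha> - s)) * ennreal ((1 - norm z * norm w) powr (1 - (2 + \<alpha>))) \<partial>lborel)"
    have R: "R \<le> ennreal (C2 * (1 - (norm z)\<^sup>2) powr (-s))"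
      using nn_integral_disc_powr[of "\<alpha> - s" "1 + \<alpha>" z] \<alpha> s z
      by (simp add: R_def C2_def ennreal_mult)
    have "(\<integral>\<^sup>+w\<in>disc. ennreal ((1 - (norm w)\<^sup>2) powr (\<alpha> - s) * kernel_majorant \<alpha> z w) \<partial>lborel)
      = (\<integral>\<^sup>+w. ennreal ((1 - (norm w)\<^sup>2) powr (\<alpha> - s)) * ennreal (norm (1 - z * cnj w) powr (-(2 + \<alpha>))) * indicator disc w
           + ennreal ((1 - (norm w)\<^sup>2) powr (\<alpha> - s)) * ennreal ((1 - norm z * norm w) powr (1 - (2 + \<alpha>))) * indicator disc w \<partial>lborel)"
      by (intro nn_integral_cong) (simp add: kernel_majorant_def distrib_left ennreal_mult split: split_indicator)
    also have "\<dots> = (\<integral>\<^sup>+w\<in>disc. ennreal ((1 - (norm w)\<^sup>2) powr (\<alpha> - s)) * ennreal (norm (1 - z * cnj w) powr (-(2 + \<alpha>))) \<partial>lborel) + R"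
      unfolding R_def by (rule nn_integral_add) measurable
    also have "\<dots> \<le> ennreal C1 * R + R"
      unfolding R_def C1_def
      by (intro add_right_mono nn_integral_disc_angular[of "\<lambda>r. ennreal ((1 - r\<^sup>2) powr (\<alpha> - s))"])
        (use \<alpha> z in auto)
    also have "\<dots> = ennreal (C1 + 1) * R" using C by (simp add: distrib_right)
    also have "\<dots> \<le> ennreal (C1 + 1) * ennreal (C2 * (1 - (norm z)\<^sup>2) powr (-s))"
      by (intro mult_left_mono R) auto
    also have "\<dots> = ennreal ((C1 + 1) * C2 * (1 - (norm z)\<^sup>2) powr (-s))"
      using C by (subst ennreal_mult[symmetric]) (auto simp: mult.assoc)
    finally show "(\<integral>\<^sup>+w\<in>disc. ennreal ((1 - (norm w)\<^sup>2) powr (\<alpha> - s) * kernel_majorant \<alpha> z w) \<partial>lborel)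
      \<le> ennreal ((C1 + 1) * C2 * (1 - (norm z)\<^sup>2) powr (-s))" .
  qed (use C in auto)
qed

lemma nn_integral_area: "(\<integral>\<^sup>+z. f z \<partial>area) = (\<integral>\<^sup>+z\<in>disc. f z \<partial>lborel)"
  by (simp add: nn_integral_restrict_space nn_integral_completion)

lemma nn_integral_area_moment:
  fixes \<beta> :: real
  assumes "\<beta> > -1"
  shows "(\<integral>\<^sup>+z. ennreal (norm z ^ (2 * n) * (1 - (norm z)\<^sup>2) powr \<beta>) \<partial>area)
    = ennreal (pi * Beta (real n + 1) (\<beta> + 1))"
proof -
  have "(\<integral>\<^sup>+z. ennreal (norm z ^ (2 * n) * (1 - (norm z)\<^sup>2) powr \<beta>) \<partial>area)
      = (\<integral>\<^sup>+z\<in>disc. ennreal (((norm z)\<^sup>2) ^ n * (1 - (norm z)\<^sup>2) powr \<beta>) \<partial>lborel)"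
    by (simp add: nn_integral_area power_mult)
  also have "\<dots> = ennreal pi * (\<integral>\<^sup>+t\<in>{0..1}. ennreal (t ^ n * (1 - t) powr \<beta>) \<partial>lborel)"
    by (rule nn_integral_disc_radial) measurable
  also have "(\<integral>\<^sup>+t\<in>{0..1}. ennreal (t ^ n * (1 - t) powr \<beta>) \<partial>lborel)
      = (\<integral>\<^sup>+t\<in>{0..1}. ennreal (t powr (real n + 1 - 1) * (1 - t) powr (\<beta> + 1 - 1)) \<partial>lborel)"
    \<comment> \<open>At t = 0 and n = 0 the two powers differ: \<open>0 ^ 0\<close> is 1 but
      \<open>0 powr 0\<close> is 0.\<close>
    by (rule nn_integral_cong_AE, use AE_lborel_singleton[of 0] in eventually_elim)
      (auto simp: powr_realpow split: split_indicator)
  also have "\<dots> = ennreal (Beta (real n + 1) (\<beta> + 1))"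
    by (rule nn_integral_has_integral_lebesgue') (use has_integral_Beta_real[of "real n + 1" "\<beta> + 1"] assms in auto)
  finally show ?thesis by (simp add: ennreal_mult')
qed

section \<open>Asymptotics of the kernel coefficients\<close>

text \<open>This is the origin of the kernel exponent: the reciprocal moments of the pure power
  weight are (\<alpha> + 1) / pi times the binomial coefficients of (1 - x)^(-(\<alpha> +
  2)).\<close>

lemma Beta_eq_inverse_pochhammer:
  fixes \<alpha> :: real
  assumes "\<alpha> > -1"
  shows "Beta (real n + 1) (\<alpha> + 1) = 1 / ((\<alpha> + 1) * (pochhammer (\<alpha> + 2) n / fact n))"
proof -
  have ne: "\<alpha> + 2 \<notin> \<int>\<^sub>\<le>\<^sub>0" "\<alpha> + 1 \<notin> \<int>\<^sub>\<le>\<^sub>0"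
    using assms by (auto elim!: nonpos_Ints_cases)
  define g G where "g = Gamma (\<alpha> + 1)" and "G = Gamma (\<alpha> + 2 + real n)"
  have g: "g > 0" using assms by (simp add: g_def Gamma_real_pos)
  have "Gamma (\<alpha> + 2) = (\<alpha> + 1) * g"
    using Gamma_plus1[OF ne(2)] by (simp add: add.assoc g_def)
  then have poch: "pochhammer (\<alpha> + 2) n = G / ((\<alpha> + 1) * g)"
    by (simp add: pochhammer_Gamma[OF ne(1)] G_def)
  have "Gamma (real n + 1) = fact n"
    using Gamma_fact[of n, where 'a = real] by (simp add: add.commute)
  moreover have "Gamma (real n + 1 + (\<alpha> + 1)) = G" by (simp add: G_def add_ac)
  ultimately show ?thesis
    unfolding Beta_def poch g_def[symmetric] using assms g by simp
qed

text \<open>Newton's series for exponent -a at -\<zeta>: the two alternating signs cancel, so for a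
  > 0 the coefficients are positive. The real version below then sums absolute values.\<close>

lemma sums_pochhammer:
  fixes a :: real and \<zeta> :: complex
  assumes "norm \<zeta> < 1"
  shows "(\<lambda>n. of_real (pochhammer a n / fact n) * \<zeta> ^ n) sums ((1 - \<zeta>) powr (- of_real a))"
proof -
  have "(\<lambda>n. (- of_real a gchoose n) * (- \<zeta>) ^ n) sums (1 + - \<zeta>) powr (- of_real a)"
    using assms by (intro gen_binomial_complex) simp
  moreover have "(- of_real a gchoose n) * (- \<zeta>) ^ n = of_real (pochhammer a n / fact n) * \<zeta> ^ n" for n
  proof -
    have "(- 1) ^ n * (- \<zeta>) ^ n = \<zeta> ^ n" by (simp flip: power_mult_distrib)
    then show ?thesis by (simp add: gbinomial_pochhammer pochhammer_of_real mult_ac)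
  qed
  ultimately show ?thesis by simp
qed

lemma sums_pochhammer_real:
  fixes a x :: real
  assumes "\<bar>x\<bar> < 1"
  shows "(\<lambda>n. pochhammer a n / fact n * x ^ n) sums ((1 - x) powr (-a))"
proof -
  have "(\<lambda>n. (- a gchoose n) * (- x) ^ n) sums (1 + - x) powr (- a)"
    using assms by (intro gen_binomial_real) simp
  moreover have "(- a gchoose n) * (- x) ^ n = pochhammer a n / fact n * x ^ n" for n
  proof -
    have "(- 1) ^ n * (- x) ^ n = x ^ n" by (simp flip: power_mult_distrib)
    then show ?thesis by (simp add: gbinomial_pochhammer mult_ac)
  qed
  ultimately show ?thesis by simp
qed

text \<open>Compactness gives the extreme values of \<open>M\<close>. The derivative
  \<open>g'\<close> is continuous, being differentiable, so its largest modulus is a Lipschitz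
  constant by the mean value estimate.\<close>

lemma C2_on_imp_bounds:
  assumes "C2_on {0..1} M" and pos: "\<And>r. r \<in> {0..1} \<Longrightarrow> M r > 0"
  obtains m K L where "continuous_on {0..1} M" "m > 0" "L \<ge> 0"
    "\<And>r. r \<in> {0..1} \<Longrightarrow> m \<le> M r" "\<And>r. r \<in> {0..1} \<Longrightarrow> M r \<le> K"
    "\<And>r. r \<in> {0..1} \<Longrightarrow> \<bar>M r - M 1\<bar> \<le> L * (1 - r)"
proof -
  obtain g' g'' where g: "\<And>x. x \<in> {0..1} \<Longrightarrow> (M has_real_derivative g' x) (at x within {0..1})"
    "\<And>x. x \<in> {0..1} \<Longrightarrow> (g' has_real_derivative g'' x) (at x within {0..1})"
    using assms(1) unfolding C2_on_def by blast
  have cont: "continuous_on {0..1} M" "continuous_on {0..1} g'"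
    using g by (blast intro: DERIV_continuous_on)+
  obtain a where a: "a \<in> {0..1}" "\<And>r. r \<in> {0..1} \<Longrightarrow> M a \<le> M r"
    using continuous_attains_inf[OF _ _ cont(1)] by auto
  obtain b where b: "b \<in> {0..1}" "\<And>r. r \<in> {0..1} \<Longrightarrow> M r \<le> M b"
    using continuous_attains_sup[OF _ _ cont(1)] by auto
  obtain c where c: "c \<in> {0..1}" "\<And>r. r \<in> {0..1} \<Longrightarrow> \<bar>g' r\<bar> \<le> \<bar>g' c\<bar>"
    using continuous_attains_sup[of "{0..1}" "\<lambda>r. \<bar>g' r\<bar>"]
      continuous_on_rabs[OF cont(2)] by auto
  have "\<bar>M r - M 1\<bar> \<le> \<bar>g' c\<bar> * (1 - r)" if "r \<in> {0..1}" for r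
    using field_differentiable_bound[of "{0..1}" M g' "\<bar>g' c\<bar>" r 1] g(1) c(2) that by auto
  then show thesis using that[of "M a" "\<bar>g' c\<bar>" "M b"] cont(1) a b pos by auto
qed

section \<open>Moments of weights comparable to a power of 1 - |z|^2\<close>

lemma borel_imp_area_measurable: "f \<in> borel_measurable borel \<Longrightarrow> f \<in> borel_measurable area"
  by (intro measurable_restrict_space1 measurable_completion) simp

definition moment :: "real \<Rightarrow> nat \<Rightarrow> real" where
  "moment \<beta> n = pi * Beta (real n + 1) (\<beta> + 1)"

lemma
  assumes "\<beta> > -1"
  shows integrable_moment: "integrable area (\<lambda>z. norm z ^ (2 * n) * (1 - (norm z)\<^sup>2) powr \<beta>)"
    and integral_moment: "(LINT z|area. norm z ^ (2 * n) * (1 - (norm z)\<^sup>2) powr \<beta>) = moment \<beta> n"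
proof -
  have "Beta (real n + 1) (\<beta> + 1) > 0"
    using assms by (auto simp: Beta_def intro!: divide_pos_pos mult_pos_pos Gamma_real_pos)
  moreover have "(\<lambda>z::complex. norm z ^ (2 * n) * (1 - (norm z)\<^sup>2) powr \<beta>) \<in> borel_measurable area"
    by (rule borel_imp_area_measurable) measurable
  ultimately have "integrable area (\<lambda>z. norm z ^ (2 * n) * (1 - (norm z)\<^sup>2) powr \<beta>) \<and>
      (LINT z|area. norm z ^ (2 * n) * (1 - (norm z)\<^sup>2) powr \<beta>) = moment \<beta> n"
    using nn_integral_area_moment[OF assms, of n]
    by (subst nn_integral_eq_integrable[symmetric]) (auto simp: moment_def)
  then show "integrable area (\<lambda>z. norm z ^ (2 * n) * (1 - (norm z)\<^sup>2) powr \<beta>)"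
    "(LINT z|area. norm z ^ (2 * n) * (1 - (norm z)\<^sup>2) powr \<beta>) = moment \<beta> n" by blast+
qed

text \<open>Each constant has its task: \<open>m\<close> bounds the moments below so that they can
  be inverted, \<open>K\<close> carries integral bounds from the power weight to
  \<open>\<mu>\<close>, and \<open>L\<close> controls the deviation from the boundary value
  \<open>M 1\<close>.\<close>

locale comparable_weight =
  fixes \<alpha> :: real and M :: "real \<Rightarrow> real" and m K L :: real
  assumes \<alpha>: "\<alpha> > -1" and M_cont: "continuous_on {0..1} M" and m_pos: "m > 0" and L_nonneg: "L \<ge> 0"
    and m_le: "\<And>r. r \<in> {0..1} \<Longrightarrow> m \<le> M r" and le_K: "\<And>r. r \<in> {0..1} \<Longrightarrow> M r \<le> K"
    and M_lipschitz: "\<And>r. r \<in> {0..1} \<Longrightarrow> \<bar>M r - M 1\<bar> \<le> L * (1 - r)"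
begin

definition \<mu> :: "complex \<Rightarrow> real" where "\<mu> = radial_weight M \<alpha>"

lemma weight_bounds:
  assumes "norm z < 1"
  shows "m * (1 - (norm z)\<^sup>2) powr \<alpha> \<le> \<mu> z" and "\<mu> z \<le> K * (1 - (norm z)\<^sup>2) powr \<alpha>"
    and "\<bar>\<mu> z - M 1 * (1 - (norm z)\<^sup>2) powr \<alpha>\<bar> \<le> L * (1 - (norm z)\<^sup>2) powr (\<alpha> + 1)"
proof -
  have z: "norm z \<in> {0..1}" using assms by simp
  show "m * (1 - (norm z)\<^sup>2) powr \<alpha> \<le> \<mu> z" "\<mu> z \<le> K * (1 - (norm z)\<^sup>2) powr \<alpha>"
    unfolding \<mu>_def radial_weight_def by (intro mult_right_mono m_le[OF z] le_K[OF z]; simp)+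
  \<comment> \<open>Since r^2 \<le> r gives 1 - r \<le> 1 - r^2, the Lipschitz bound becomes one
    more power of 1 - |z|^2.\<close>
  have sq: "(norm z)\<^sup>2 \<le> norm z" "(norm z)\<^sup>2 < 1"
    using assms mult_left_le[of "norm z" "norm z"] by (simp_all add: abs_square_less_1 power2_eq_square[of "norm z"])
  have "\<bar>\<mu> z - M 1 * (1 - (norm z)\<^sup>2) powr \<alpha>\<bar> = \<bar>M (norm z) - M 1\<bar> * (1 - (norm z)\<^sup>2) powr \<alpha>"
    by (simp add: \<mu>_def radial_weight_def abs_mult flip: left_diff_distrib)
  also have "\<dots> \<le> (L * (1 - (norm z)\<^sup>2)) * (1 - (norm z)\<^sup>2) powr \<alpha>"
    using M_lipschitz[OF z] sq L_nonneg
    by (intro mult_right_mono order_trans[OF M_lipschitz[OF z]] mult_left_mono) auto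
  also have "\<dots> = L * (1 - (norm z)\<^sup>2) powr (\<alpha> + 1)"
    using sq by (simp add: powr_add)
  finally show "\<bar>\<mu> z - M 1 * (1 - (norm z)\<^sup>2) powr \<alpha>\<bar> \<le> L * (1 - (norm z)\<^sup>2) powr (\<alpha> + 1)" .
qed

lemma weight_pos: "norm z < 1 \<Longrightarrow> 0 < \<mu> z"
  using weight_bounds(1)[of z] m_pos abs_square_less_1[of "norm z"]
  by (intro less_le_trans[OF _ weight_bounds(1)] mult_pos_pos) auto

lemma K_pos: "K > 0"
  using m_le[of 1] le_K[of 1] m_pos by simp

lemma M1_pos: "M 1 > 0"
  using m_le[of 1] m_pos by simp

text \<open>Nothing is known of \<open>M\<close> outside [0,1], so measurability comes from
  continuity on the disc and is relative to \<open>area\<close>.\<close>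

lemma weight_measurable [measurable]: "\<mu> \<in> borel_measurable area"
proof (rule continuous_imp_measurable_on_sets_lebesgue)
  have "(norm z)\<^sup>2 < 1" if "norm z < 1" for z :: complex
    using that by (simp add: abs_square_less_1)
  then have "continuous_on disc (\<lambda>z. (1 - (norm z)\<^sup>2) powr \<alpha>)"
    by (intro continuous_intros) (force simp: less_le)+
  moreover have "continuous_on disc (\<lambda>z. M (norm z))"
    by (rule continuous_on_compose2[OF M_cont]) (auto intro: continuous_intros)
  ultimately show "continuous_on disc \<mu>"
    unfolding \<mu>_def radial_weight_def by (intro continuous_on_mult)
qed simp

lemma integrable_weight_moment: "integrable area (\<lambda>z. norm z ^ (2 * n) * \<mu> z)"
proof (rule Bochner_Integration.integrable_bound[OF integrable_mult_right[OF integrable_moment[OF \<alpha>, of n], of K]])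
  show "(\<lambda>z. norm z ^ (2 * n) * \<mu> z) \<in> borel_measurable area"
    by (intro borel_measurable_times borel_imp_area_measurable weight_measurable) measurable
  show "AE z in area. norm (norm z ^ (2 * n) * \<mu> z) \<le> norm (K * (norm z ^ (2 * n) * (1 - (norm z)\<^sup>2) powr \<alpha>))"
  proof (rule AE_I2)
    fix z assume "z \<in> space area"
    then have z: "norm z < 1" by simp
    have "norm z ^ (2 * n) * \<mu> z \<le> norm z ^ (2 * n) * (K * (1 - (norm z)\<^sup>2) powr \<alpha>)"
      by (intro mult_left_mono weight_bounds(2)[OF z]) auto
    then show "norm (norm z ^ (2 * n) * \<mu> z) \<le> norm (K * (norm z ^ (2 * n) * (1 - (norm z)\<^sup>2) powr \<alpha>))"
      using weight_pos[OF z] K_pos by (simp add: abs_mult mult_ac)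
  qed
qed

lemma weight_moment_lower: "m * moment \<alpha> n \<le> (LINT z|area. norm z ^ (2 * n) * \<mu> z)"
  unfolding integral_moment[OF \<alpha>, symmetric] integral_mult_right_zero[symmetric]
proof (rule integral_mono[OF _ integrable_weight_moment])
  fix z assume "z \<in> space area"
  then have "norm z ^ (2 * n) * (m * (1 - (norm z)\<^sup>2) powr \<alpha>) \<le> norm z ^ (2 * n) * \<mu> z"
    by (intro mult_left_mono weight_bounds(1)) auto
  then show "m * (norm z ^ (2 * n) * (1 - (norm z)\<^sup>2) powr \<alpha>) \<le> norm z ^ (2 * n) * \<mu> z"
    by (simp add: mult_ac)
qed (intro integrable_mult_right integrable_moment \<alpha>)

text \<open>The extra power of 1 - |z|^2 in the pointwise deviation raises the moment parameter by
  one, which makes the moment smaller by a factor of order n.\<close>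

lemma weight_moment_diff:
  "\<bar>(LINT z|area. norm z ^ (2 * n) * \<mu> z) - M 1 * moment \<alpha> n\<bar> \<le> L * moment (\<alpha> + 1) n"
proof -
  have "\<bar>(LINT z|area. norm z ^ (2 * n) * \<mu> z) - M 1 * moment \<alpha> n\<bar>
     = norm (LINT z|area. norm z ^ (2 * n) * \<mu> z - M 1 * (norm z ^ (2 * n) * (1 - (norm z)\<^sup>2) powr \<alpha>))"
    by (subst Bochner_Integration.integral_diff)
      (auto simp: integral_moment[OF \<alpha>] intro!: integrable_weight_moment integrable_mult_right integrable_moment \<alpha>)
  also have "\<dots> \<le> (LINT z|area. L * (norm z ^ (2 * n) * (1 - (norm z)\<^sup>2) powr (\<alpha> + 1)))"
  proof (rule Bochner_Integration.integral_norm_bound_integral)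
    fix z assume "z \<in> space area"
    then have z: "norm z < 1" by simp
    have "norm (norm z ^ (2 * n) * \<mu> z - M 1 * (norm z ^ (2 * n) * (1 - (norm z)\<^sup>2) powr \<alpha>))
       = norm z ^ (2 * n) * \<bar>\<mu> z - M 1 * (1 - (norm z)\<^sup>2) powr \<alpha>\<bar>"
      by (simp add: mult.left_commute[of "M 1"] abs_mult flip: right_diff_distrib)
    also have "\<dots> \<le> norm z ^ (2 * n) * (L * (1 - (norm z)\<^sup>2) powr (\<alpha> + 1))"
      by (intro mult_left_mono weight_bounds(3)[OF z]) auto
    finally show "norm (norm z ^ (2 * n) * \<mu> z - M 1 * (norm z ^ (2 * n) * (1 - (norm z)\<^sup>2) powr \<alpha>))
       \<le> L * (norm z ^ (2 * n) * (1 - (norm z)\<^sup>2) powr (\<alpha> + 1))" by (simp add: mult_ac)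
  qed (use \<alpha> in \<open>auto intro!: integrable_weight_moment integrable_moment Bochner_Integration.integrable_diff integrable_mult_right\<close>)
  also have "\<dots> = L * moment (\<alpha> + 1) n"
    using integral_moment[of "\<alpha> + 1" n] \<alpha> by simp
  finally show ?thesis .
qed

text \<open>By Beta asymptotics \<open>c0\<close> is the exact leading coefficient of \<open>kernel_coeff \<mu>\<close>; the Lipschitz
  bound on \<open>M\<close> at \<open>1\<close> gains one power of \<open>n\<close> in the remainder, which \<open>c1\<close> controls.\<close>
definition c0 :: real where "c0 = (\<alpha> + 1) / (pi * M 1)"
definition c1 :: real where "c1 = L * (\<alpha> + 1) / (pi * m * M 1)"

lemma c0_pos: "c0 > 0" and c1_nonneg: "c1 \<ge> 0"
  using \<alpha> M1_pos m_pos L_nonneg by (simp_all add: c0_def c1_def)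

text \<open>With \<open>B\<close> the moment of \<open>\<mu>\<close>, the difference of reciprocals
  is (M 1 * I - B) / (B * (M 1 * I)). Its numerator is at most L * J in modulus and B \<ge> m * I;
  the Beta recursion gives J / I, and 1 / I is (\<alpha> + 1) p / pi. These factors make up
  \<open>c1\<close>.\<close>

lemma kernel_coeff_diff:
  "\<bar>kernel_coeff \<mu> n - c0 * (pochhammer (\<alpha> + 2) n / fact n)\<bar> \<le> c1 * (pochhammer (\<alpha> + 1) n / fact n)"
proof -
  define I J B where "I = moment \<alpha> n" and "J = moment (\<alpha> + 1) n"
    and "B = (LINT z|area. norm z ^ (2 * n) * \<mu> z)"
  define p where "p = pochhammer (\<alpha> + 2) n / fact n"
  have p: "p > 0" using \<alpha> by (auto simp: p_def intro!: divide_pos_pos pochhammer_pos)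
  have I: "I = pi / ((\<alpha> + 1) * p)"
    using Beta_eq_inverse_pochhammer[OF \<alpha>, of n] by (simp add: I_def moment_def p_def)
  have Ipos: "I > 0" using p \<alpha> by (simp add: I)
  have B: "m * I \<le> B" "\<bar>B - M 1 * I\<bar> \<le> L * J"
    using weight_moment_lower weight_moment_diff by (auto simp: B_def I_def J_def)
  have Bpos: "B > 0" using B(1) Ipos m_pos by (auto intro: less_le_trans[OF mult_pos_pos])
  have "\<alpha> + 1 \<notin> \<int>\<^sub>\<le>\<^sub>0" using \<alpha> by (auto elim!: nonpos_Ints_cases)
  from Beta_plus1_right[OF this, of "real n + 1"]
  have J: "(real n + \<alpha> + 2) * J = (\<alpha> + 1) * I"
    by (simp add: I_def J_def moment_def algebra_simps)
  \<comment> \<open>Both sides, times n!, are the rising product of n + 1 factors from \<alpha> + 1,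
    with its lowest or its highest factor split off.\<close>
  have poch: "(\<alpha> + 1) * p = (pochhammer (\<alpha> + 1) n / fact n) * (\<alpha> + 1 + n)"
    using pochhammer_rec[of "\<alpha> + 1" n] pochhammer_rec'[of "\<alpha> + 1" n]
    by (simp add: p_def algebra_simps)
  have "kernel_coeff \<mu> n - c0 * p = (M 1 * I - B) / (B * (M 1 * I))"
  proof -
    have "kernel_coeff \<mu> n = 1 / B" by (simp add: kernel_coeff_def B_def)
    moreover have "c0 * p = 1 / (M 1 * I)" using \<alpha> by (simp add: c0_def I)
    ultimately show ?thesis using Bpos Ipos M1_pos by (simp add: field_simps)
  qed
  then have "\<bar>kernel_coeff \<mu> n - c0 * p\<bar> = \<bar>B - M 1 * I\<bar> / (B * (M 1 * I))"
    using Bpos Ipos M1_pos by (simp add: abs_mult abs_minus_commute)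
  also have "\<dots> \<le> (L * J) / ((m * I) * (M 1 * I))"
    using B Bpos Ipos M1_pos m_pos by (intro frac_le mult_right_mono) (auto intro: order_trans[OF _ B(2)])
  also have "\<dots> = L / (m * M 1) * (J / I) / I" by simp
  also have "J / I = (\<alpha> + 1) / (real n + \<alpha> + 2)"
    using J Ipos \<alpha> by (simp add: field_simps)
  also have "L / (m * M 1) * ((\<alpha> + 1) / (real n + \<alpha> + 2)) / I
     = L * (\<alpha> + 1) / (pi * m * M 1) * ((\<alpha> + 1) * p / (real n + \<alpha> + 2))"
    using p \<alpha> by (simp add: I)
  also have "\<dots> = c1 * ((pochhammer (\<alpha> + 1) n / fact n) * ((\<alpha> + 1 + n) / (real n + \<alpha> + 2)))"
    unfolding poch c1_def by simp
  also have "\<dots> \<le> c1 * ((pochhammer (\<alpha> + 1) n / fact n) * 1)"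
    using \<alpha> c1_nonneg by (intro mult_left_mono) (auto intro!: divide_nonneg_pos less_imp_le[OF pochhammer_pos])
  finally show ?thesis by (simp add: p_def)
qed

section \<open>Pointwise bounds for the kernel\<close>

text \<open>The main series is summed with its phases into a complex power with real exponent, whose
  modulus is explicit; the remainder \<open>e\<close> is compared with the real series at |\<zeta>|.
  Absolute convergence is recorded for the later exchange of sum and integral.\<close>

lemma
  assumes \<zeta>: "norm \<zeta> < 1"
  shows summable_kernel: "summable (\<lambda>n. norm (of_real (kernel_coeff \<mu> n) * \<zeta> ^ n :: complex))"
    and norm_kernel_series_le: "norm (\<Sum>n. of_real (kernel_coeff \<mu> n) * \<zeta> ^ n :: complex)
      \<le> c0 * norm (1 - \<zeta>) powr (-(2 + \<alpha>)) + c1 * (1 - norm \<zeta>) powr (-(1 + \<alpha>))"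
proof -
  define p q where "p n = pochhammer (\<alpha> + 2) n / fact n" and "q n = pochhammer (\<alpha> + 1) n / fact n" for n
  define e where "e n = kernel_coeff \<mu> n - c0 * p n" for n
  have pq: "p n \<ge> 0" "q n \<ge> 0" for n
    using \<alpha> by (auto simp: p_def q_def intro!: divide_nonneg_pos less_imp_le[OF pochhammer_pos])
  have e: "\<bar>e n\<bar> \<le> c1 * q n" for n
    using kernel_coeff_diff[of n] by (simp add: e_def p_def q_def)
  have P: "(\<lambda>n. p n * norm \<zeta> ^ n) sums ((1 - norm \<zeta>) powr (-(\<alpha> + 2)))"
    and Q: "(\<lambda>n. q n * norm \<zeta> ^ n) sums ((1 - norm \<zeta>) powr (-(\<alpha> + 1)))"
    unfolding p_def q_def by (rule sums_pochhammer_real; use \<zeta> in simp)+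
  have Pc: "(\<lambda>n. of_real (p n) * \<zeta> ^ n) sums ((1 - \<zeta>) powr (- of_real (\<alpha> + 2)))"
    unfolding p_def by (rule sums_pochhammer[OF \<zeta>])
  have Eb: "norm (of_real (e n) * \<zeta> ^ n) \<le> c1 * (q n * norm \<zeta> ^ n)" for n
    using mult_right_mono[OF e[of n], of "norm \<zeta> ^ n"] by (simp add: norm_mult norm_power mult.assoc)
  have Qs: "(\<lambda>n. c1 * (q n * norm \<zeta> ^ n)) sums (c1 * (1 - norm \<zeta>) powr (-(\<alpha> + 1)))"
    by (rule sums_mult[OF Q])
  have E: "summable (\<lambda>n. norm (of_real (e n) * \<zeta> ^ n))"
    by (rule summable_comparison_test'[OF sums_summable[OF Qs], of 0]) (use Eb in simp)
  have dec: "of_real (kernel_coeff \<mu> n) * \<zeta> ^ n = of_real c0 * (of_real (p n) * \<zeta> ^ n) + of_real (e n) * \<zeta> ^ n" for n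
    by (simp add: e_def algebra_simps)
  have "summable (\<lambda>n. c0 * (p n * norm \<zeta> ^ n) + norm (of_real (e n) * \<zeta> ^ n))"
    by (intro summable_add summable_mult sums_summable[OF P] E)
  then show "summable (\<lambda>n. norm (of_real (kernel_coeff \<mu> n) * \<zeta> ^ n :: complex))"
  proof (rule summable_comparison_test'[of _ 0])
    fix n
    show "norm (norm (of_real (kernel_coeff \<mu> n) * \<zeta> ^ n :: complex))
        \<le> c0 * (p n * norm \<zeta> ^ n) + norm (of_real (e n) * \<zeta> ^ n)"
      unfolding dec real_norm_def abs_norm_cancel
      by (rule order_trans[OF norm_triangle_ineq]) (use c0_pos pq in \<open>simp add: norm_mult norm_power\<close>)
  qed
  have "(\<lambda>n. of_real c0 * (of_real (p n) * \<zeta> ^ n) + of_real (e n) * \<zeta> ^ n)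
      sums (of_real c0 * (1 - \<zeta>) powr (- of_real (\<alpha> + 2)) + (\<Sum>n. of_real (e n) * \<zeta> ^ n))"
    by (intro sums_add sums_mult Pc summable_sums summable_norm_cancel[OF E])
  then have "(\<Sum>n. of_real (kernel_coeff \<mu> n) * \<zeta> ^ n)
      = of_real c0 * (1 - \<zeta>) powr (- of_real (\<alpha> + 2)) + (\<Sum>n. of_real (e n) * \<zeta> ^ n)"
    unfolding dec by (rule sums_unique[symmetric])
  also have "norm \<dots> \<le> norm (of_real c0 * (1 - \<zeta>) powr (- of_real (\<alpha> + 2))) + norm (\<Sum>n. of_real (e n) * \<zeta> ^ n)"
    by (rule norm_triangle_ineq)
  also have "norm (of_real c0 * (1 - \<zeta>) powr (- of_real (\<alpha> + 2))) = c0 * norm (1 - \<zeta>) powr (-(2 + \<alpha>))"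
    using c0_pos by (simp add: norm_mult norm_powr_real_powr' add.commute)
  also have "norm (\<Sum>n. of_real (e n) * \<zeta> ^ n) \<le> (\<Sum>n. c1 * (q n * norm \<zeta> ^ n))"
    by (rule order_trans[OF summable_norm[OF E]] suminf_le[OF Eb E sums_summable[OF Qs]])+
  also have "\<dots> = c1 * (1 - norm \<zeta>) powr (-(1 + \<alpha>))"
    using sums_unique[OF Qs] by (simp add: add.commute)
  finally show "norm (\<Sum>n. of_real (kernel_coeff \<mu> n) * \<zeta> ^ n :: complex)
      \<le> c0 * norm (1 - \<zeta>) powr (-(2 + \<alpha>)) + c1 * (1 - norm \<zeta>) powr (-(1 + \<alpha>))" by simp
qed

lemma norm_bergman_kernel_le:
  assumes z: "norm z < 1" and w: "norm w < 1"
  shows "norm (bergman_kernel \<mu> z w) \<le> (c0 + c1) * kernel_majorant \<alpha> z w"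
proof -
  have "norm (z * cnj w) < 1"
    using z w mult_strict_mono'[of "norm z" 1 "norm w" 1] by (simp add: norm_mult)
  from norm_kernel_series_le[OF this]
  have "norm (bergman_kernel \<mu> z w)
      \<le> c0 * norm (1 - z * cnj w) powr (-(2 + \<alpha>)) + c1 * (1 - norm z * norm w) powr (-(1 + \<alpha>))"
    by (simp add: bergman_kernel_def norm_mult)
  also have "\<dots> \<le> (c0 + c1) * norm (1 - z * cnj w) powr (-(2 + \<alpha>))
      + (c0 + c1) * (1 - norm z * norm w) powr (-(1 + \<alpha>))"
    using c0_pos c1_nonneg by (intro add_mono mult_right_mono) auto
  finally show ?thesis by (simp add: kernel_majorant_def distrib_left)
qed

end

section \<open>The Schur test\<close>

text \<open>Young's inequality for the factors u * l^((1-p)/p) and l^((p-1)/p), whose product is u.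
  Equality holds at u = l, so the free \<open>l\<close> can balance the two terms.\<close>

lemma Youngs_inequality_scaled:
  fixes p q l u :: real
  assumes pq: "p > 1" "q > 1" "1 / p + 1 / q = 1" and l: "l > 0" and u: "u \<ge> 0"
  shows "u \<le> l powr (1 - p) / p * u powr p + l / q"
proof -
  have e: "(1 - p) / p * p = 1 - p" "(p - 1) / p * q = 1" "(1 - p) / p + (p - 1) / p = 0"
    using pq by (auto simp: field_simps)
  have "u = (u * l powr ((1 - p) / p)) * l powr ((p - 1) / p)"
    using l e(3) by (simp add: mult.assoc flip: powr_add)
  also have "\<dots> \<le> (u * l powr ((1 - p) / p)) powr p / p + (l powr ((p - 1) / p)) powr q / q"
    using pq u by (intro Youngs_inequality) auto
  also have "(u * l powr ((1 - p) / p)) powr p = u powr p * l powr (1 - p)"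
    using l u pq(1) by (simp add: powr_mult powr_powr)
  also have "(l powr ((p - 1) / p)) powr q = l"
    using l e(2) by (simp add: powr_powr)
  finally show ?thesis by (simp add: mult.commute)
qed

text \<open>Avoids powers of extended reals: Young is applied with the parameter \<open>l\<close> that balances the two
  integrals.\<close>
lemma weighted_Holder:
  fixes p q A g :: real and h f :: "'a \<Rightarrow> real" and k :: "'a \<Rightarrow> ennreal"
  assumes pq: "p > 1" "q > 1" "1 / p + 1 / q = 1" and A: "A > 0" and g: "g \<ge> 0"
    and [measurable]: "k \<in> borel_measurable N" "h \<in> borel_measurable N" "f \<in> borel_measurable N"
    and h: "\<And>w. w \<in> space N \<Longrightarrow> h w > 0" and f: "\<And>w. w \<in> space N \<Longrightarrow> f w \<ge> 0"
    and kh: "(\<integral>\<^sup>+w. k w * ennreal (h w powr q) \<partial>N) \<le> ennreal A"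
    and gk: "ennreal g \<le> (\<integral>\<^sup>+w. k w * ennreal (f w) \<partial>N)"
  shows "ennreal (g powr p)
    \<le> ennreal (A powr (p - 1)) * (\<integral>\<^sup>+w. k w * ennreal (f w powr p * h w powr (-p)) \<partial>N)"
proof (cases "(\<integral>\<^sup>+w. k w * ennreal (f w powr p * h w powr (-p)) \<partial>N) = \<infinity>")
  case True
  then show ?thesis using A by (simp add: ennreal_mult_top)
next
  case False
  then obtain b where b: "b \<ge> 0" "(\<integral>\<^sup>+w. k w * ennreal (f w powr p * h w powr (-p)) \<partial>N) = ennreal b"
    by (cases "\<integral>\<^sup>+w. k w * ennreal (f w powr p * h w powr (-p)) \<partial>N") auto
  have "g powr p / A powr (p - 1) \<le> b"
  proof (rule dense_ge)
    \<comment> \<open>Working with c > b keeps the parameter \<open>l\<close> positive even when b =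
      0.\<close>
    fix c assume c: "b < c"
    \<comment> \<open>Chosen so that l^(1-p) * c = l * A: the two terms become l A / p and l A / q,
      whose sum is l A, and (l A)^p = c A^(p-1).\<close>
    define l where "l = (c / A) powr (1 / p)"
    have l: "l > 0" using A b c by (simp add: l_def)
    have lp: "l powr p = c / A" using A b c pq by (simp add: l_def powr_powr)
    have "q - q * p = - p" using pq by (simp add: field_simps)
    \<comment> \<open>Young is applied to u = f h^(-q) and multiplied by h^q; the exponent of
      \<open>h\<close> in the first term is q - q p = -p.\<close>
    have pt: "f w \<le> l powr (1 - p) / p * (f w powr p * h w powr (-p)) + l / q * h w powr q"
      if w: "w \<in> space N" for w
    proof -
      have "f w * h w powr (-q) \<le> l powr (1 - p) / p * (f w * h w powr (-q)) powr p + l / q"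
        by (rule Youngs_inequality_scaled[OF pq l]) (use f[OF w] in simp)
      then have "f w * h w powr (-q) * h w powr q
          \<le> (l powr (1 - p) / p * (f w * h w powr (-q)) powr p + l / q) * h w powr q"
        by (rule mult_right_mono) simp
      also have "f w * h w powr (-q) * h w powr q = f w"
        using h[OF w] by (simp add: mult.assoc flip: powr_add)
      also have "(f w * h w powr (-q)) powr p = f w powr p * h w powr (- q * p)"
        using f[OF w] by (simp add: powr_mult powr_powr)
      also have "(l powr (1 - p) / p * (f w powr p * h w powr (- q * p)) + l / q) * h w powr q
          = l powr (1 - p) / p * (f w powr p * (h w powr (- q * p) * h w powr q)) + l / q * h w powr q"
        by (simp add: algebra_simps)
      also have "h w powr (- q * p) * h w powr q = h w powr (-p)"
        using \<open>q - q * p = - p\<close> by (simp flip: powr_add)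
      finally show ?thesis .
    qed
    have "ennreal g \<le> (\<integral>\<^sup>+w. k w * ennreal (f w) \<partial>N)" by (rule gk)
    also have "\<dots> \<le> (\<integral>\<^sup>+w. ennreal (l powr (1 - p) / p) * (k w * ennreal (f w powr p * h w powr (-p)))
         + ennreal (l / q) * (k w * ennreal (h w powr q)) \<partial>N)"
    proof (rule nn_integral_mono)
      fix w assume w: "w \<in> space N"
      have "k w * ennreal (f w)
          \<le> k w * ennreal (l powr (1 - p) / p * (f w powr p * h w powr (-p)) + l / q * h w powr q)"
        by (intro mult_left_mono ennreal_leI pt[OF w]) simp
      also have "ennreal (l powr (1 - p) / p * (f w powr p * h w powr (-p)) + l / q * h w powr q)
          = ennreal (l powr (1 - p) / p) * ennreal (f w powr p * h w powr (-p)) + ennreal (l / q) * ennreal (h w powr q)"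
      proof -
        have "l powr (1 - p) / p \<ge> 0" "l / q \<ge> 0" using l pq by simp_all
        then show ?thesis by (simp only: ennreal_plus ennreal_mult powr_ge_zero mult_nonneg_nonneg)
      qed
      finally show "k w * ennreal (f w) \<le> ennreal (l powr (1 - p) / p) * (k w * ennreal (f w powr p * h w powr (-p)))
         + ennreal (l / q) * (k w * ennreal (h w powr q))"
        by (simp add: distrib_left mult_ac)
    qed
    also have "\<dots> = ennreal (l powr (1 - p) / p) * ennreal b
        + ennreal (l / q) * (\<integral>\<^sup>+w. k w * ennreal (h w powr q) \<partial>N)"
      by (simp add: nn_integral_add nn_integral_cmult b(2))
    also have "\<dots> \<le> ennreal (l powr (1 - p) / p) * ennreal c + ennreal (l / q) * ennreal A"
      using c by (intro add_mono mult_left_mono kh ennreal_leI) auto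
    also have "\<dots> = ennreal (l powr (1 - p) / p * c + l / q * A)"
    proof -
      have "l powr (1 - p) / p \<ge> 0" "l / q \<ge> 0" "c \<ge> 0" "A \<ge> 0" using l pq b c A by simp_all
      then show ?thesis by (simp only: ennreal_plus ennreal_mult mult_nonneg_nonneg)
    qed
    finally have "g \<le> l powr (1 - p) / p * c + l / q * A"
      using l pq b c A by (subst (asm) ennreal_le_iff) auto
    also have "l powr (1 - p) * c = l * A"
      using l lp A b c by (simp add: powr_diff field_simps)
    then have "l powr (1 - p) / p * c + l / q * A = (1 / p + 1 / q) * (l * A)"
      by (simp add: algebra_simps)
    also have "\<dots> = l * A" by (simp add: pq)
    finally have "g powr p \<le> (l * A) powr p" using g pq by (intro powr_mono2) auto
    also have "\<dots> = c / A * A powr p" using l A lp by (simp add: powr_mult)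
    also have "\<dots> = c * A powr (p - 1)" using A by (simp add: powr_diff)
    finally show "g powr p / A powr (p - 1) \<le> c" using A by (simp add: field_simps)
  qed
  then have "g powr p \<le> A powr (p - 1) * b" using A by (simp add: field_simps)
  then show ?thesis unfolding b(2) using b(1)
    by (simp add: ennreal_leI flip: ennreal_mult)
qed

text \<open>Hoelder in w leaves the factor (C h(z)^q)^(p-1). Since q (p - 1) = p this is C^(p-1)
  h(z)^p, exactly the test function in the second kernel condition. After exchanging the integrals
  that condition yields C h(w)^p, which cancels h(w)^(-p).\<close>

lemma Schur_test:
  fixes p q C :: real and h f g :: "'a \<Rightarrow> real" and k :: "'a \<Rightarrow> 'a \<Rightarrow> ennreal"
  assumes N: "sigma_finite_measure N"
    and pq: "p > 1" "q > 1" "1 / p + 1 / q = 1" and C: "C > 0"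
    and k [measurable]: "(\<lambda>(z, w). k z w) \<in> borel_measurable (N \<Otimes>\<^sub>M N)"
    and [measurable]: "h \<in> borel_measurable N" "f \<in> borel_measurable N"
    and h: "\<And>w. w \<in> space N \<Longrightarrow> h w > 0" and f: "\<And>w. w \<in> space N \<Longrightarrow> f w \<ge> 0"
    and kq: "\<And>z. z \<in> space N \<Longrightarrow> (\<integral>\<^sup>+w. k z w * ennreal (h w powr q) \<partial>N) \<le> ennreal (C * h z powr q)"
    and kp: "\<And>w. w \<in> space N \<Longrightarrow> (\<integral>\<^sup>+z. k z w * ennreal (h z powr p) \<partial>N) \<le> ennreal (C * h w powr p)"
    and g: "\<And>z. z \<in> space N \<Longrightarrow> g z \<ge> 0"
    and gk: "\<And>z. z \<in> space N \<Longrightarrow> ennreal (g z) \<le> (\<integral>\<^sup>+w. k z w * ennreal (f w) \<partial>N)"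
  shows "(\<integral>\<^sup>+z. ennreal (g z powr p) \<partial>N) \<le> ennreal (C powr p) * (\<integral>\<^sup>+w. ennreal (f w powr p) \<partial>N)"
proof -
  interpret N: sigma_finite_measure N by fact
  interpret NN: pair_sigma_finite N N ..
  have "q * (p - 1) = p" using pq by (simp add: field_simps)
  have "(\<integral>\<^sup>+z. ennreal (g z powr p) \<partial>N)
      \<le> (\<integral>\<^sup>+z. (\<integral>\<^sup>+w. ennreal (C powr (p - 1)) * (ennreal (f w powr p * h w powr (-p)) * (k z w * ennreal (h z powr p))) \<partial>N) \<partial>N)"
  proof (rule nn_integral_mono)
    fix z assume z: "z \<in> space N"
    note [measurable] = measurable_Pair2[OF k z, unfolded prod.case]
    have "ennreal (g z powr p)
      \<le> ennreal ((C * h z powr q) powr (p - 1)) * (\<integral>\<^sup>+w. k z w * ennreal (f w powr p * h w powr (-p)) \<partial>N)"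
    proof (rule weighted_Holder[OF pq])
      show "C * h z powr q > 0" using C h[OF z] by simp
    qed (use z h f kq g gk in auto)
    also have "(C * h z powr q) powr (p - 1) = C powr (p - 1) * h z powr p"
      using C h[OF z] \<open>q * (p - 1) = p\<close> by (simp add: powr_mult powr_powr)
    also have "ennreal (C powr (p - 1) * h z powr p) * (\<integral>\<^sup>+w. k z w * ennreal (f w powr p * h w powr (-p)) \<partial>N)
      = (\<integral>\<^sup>+w. ennreal (C powr (p - 1) * h z powr p) * (k z w * ennreal (f w powr p * h w powr (-p))) \<partial>N)"
      by (rule nn_integral_cmult[symmetric]) measurable
    finally show "ennreal (g z powr p)
      \<le> (\<integral>\<^sup>+w. ennreal (C powr (p - 1)) * (ennreal (f w powr p * h w powr (-p)) * (k z w * ennreal (h z powr p))) \<partial>N)"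
      by (simp add: ennreal_mult mult_ac)
  qed
  also have "\<dots> = (\<integral>\<^sup>+w. (\<integral>\<^sup>+z. ennreal (C powr (p - 1)) * (ennreal (f w powr p * h w powr (-p)) * (k z w * ennreal (h z powr p))) \<partial>N) \<partial>N)"
    by (rule NN.Fubini') measurable
  also have "\<dots> \<le> (\<integral>\<^sup>+w. ennreal (C powr p) * ennreal (f w powr p) \<partial>N)"
  proof (rule nn_integral_mono)
    fix w assume w: "w \<in> space N"
    have "(\<lambda>z. ennreal (h z powr p)) \<in> borel_measurable N" by measurable
    moreover have "(\<lambda>z. k z w) \<in> borel_measurable N"
      using measurable_Pair1[OF k w] by simp
    ultimately have meas: "(\<lambda>z. k z w * ennreal (h z powr p)) \<in> borel_measurable N"
      by (intro borel_measurable_times_ennreal)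
    have "(\<integral>\<^sup>+z. ennreal (C powr (p - 1)) * (ennreal (f w powr p * h w powr (-p)) * (k z w * ennreal (h z powr p))) \<partial>N)
      = (\<integral>\<^sup>+z. (ennreal (C powr (p - 1)) * ennreal (f w powr p * h w powr (-p))) * (k z w * ennreal (h z powr p)) \<partial>N)"
      by (simp only: mult.assoc)
    also have "\<dots> = (ennreal (C powr (p - 1)) * ennreal (f w powr p * h w powr (-p))) * (\<integral>\<^sup>+z. k z w * ennreal (h z powr p) \<partial>N)"
      by (rule nn_integral_cmult[OF meas])
    also have "\<dots> = ennreal (C powr (p - 1)) * (ennreal (f w powr p * h w powr (-p)) * (\<integral>\<^sup>+z. k z w * ennreal (h z powr p) \<partial>N))"
      by (rule mult.assoc)
    also have "\<dots> \<le> ennreal (C powr (p - 1)) * (ennreal (f w powr p * h w powr (-p)) * ennreal (C * h w powr p))"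
      by (intro mult_left_mono kp[OF w]) auto
    also have "\<dots> = ennreal (C powr (p - 1) * (f w powr p * h w powr (-p) * (C * h w powr p)))"
      using C by (simp add: ennreal_mult)
    also have "C powr (p - 1) * (f w powr p * h w powr (-p) * (C * h w powr p))
       = (C powr (p - 1) * C powr 1) * f w powr p * (h w powr (-p) * h w powr p)"
      using C by (simp add: mult_ac)
    also have "C powr (p - 1) * C powr 1 = C powr p" by (simp only: powr_add[symmetric]) simp
    also have "h w powr (-p) * h w powr p = 1"
      using h[OF w] by (simp flip: powr_add)
    finally show "(\<integral>\<^sup>+z. ennreal (C powr (p - 1)) * (ennreal (f w powr p * h w powr (-p)) * (k z w * ennreal (h z powr p))) \<partial>N)
      \<le> ennreal (C powr p) * ennreal (f w powr p)"
      by (simp add: ennreal_mult)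
  qed
  also have "\<dots> = ennreal (C powr p) * (\<integral>\<^sup>+w. ennreal (f w powr p) \<partial>N)"
    by (rule nn_integral_cmult) measurable
  finally show ?thesis .
qed

section \<open>The weighted Bergman projection\<close>

lemma kernel_majorant_commute: "kernel_majorant \<alpha> w z = kernel_majorant \<alpha> z w"
proof -
  have "norm (1 - w * cnj z) = norm (cnj (1 - w * cnj z))" by (simp only: complex_mod_cnj)
  then show ?thesis by (simp add: kernel_majorant_def mult.commute)
qed

lemma kernel_majorant_nonneg: "kernel_majorant \<alpha> z w \<ge> 0"
  by (simp add: kernel_majorant_def)

context comparable_weight
begin

text \<open>The weight has finite mass and t \<le> 1 + t^p for t \<ge> 0. The factor
  \<open>norm w ^ (2 * 0)\<close> is 1, written as a zeroth moment.\<close>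

lemma Lp_integrable:
  assumes p: "p > 1" and f: "f \<in> Lp p \<mu>"
  shows "integrable area (\<lambda>w. f w * of_real (\<mu> w))"
proof (rule Bochner_Integration.integrable_bound)
  have [measurable]: "f \<in> borel_measurable area" and i: "integrable area (\<lambda>z. norm (f z) powr p * \<mu> z)"
    using f by (auto simp: Lp_def)
  show "integrable area (\<lambda>w. norm w ^ (2 * 0) * \<mu> w + norm (f w) powr p * \<mu> w)"
    by (intro Bochner_Integration.integrable_add integrable_weight_moment i)
  show "(\<lambda>w. f w * of_real (\<mu> w)) \<in> borel_measurable area" by measurable
  show "AE w in area. norm (f w * of_real (\<mu> w)) \<le> norm (norm w ^ (2 * 0) * \<mu> w + norm (f w) powr p * \<mu> w)"
  proof (rule AE_I2)
    fix w assume "w \<in> space area"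
    then have w: "\<mu> w > 0" by (intro weight_pos) simp
    have "norm (f w) \<le> 1 + norm (f w) powr p"
    proof (cases "norm (f w) \<le> 1")
      case False
      then have "norm (f w) powr 1 \<le> norm (f w) powr p" using p by (intro powr_mono) auto
      with False show ?thesis by simp
    qed (simp add: add_increasing2)
    then have "norm (f w) * \<mu> w \<le> (1 + norm (f w) powr p) * \<mu> w" using w by (intro mult_right_mono) auto
    then show "norm (f w * of_real (\<mu> w)) \<le> norm (norm w ^ (2 * 0) * \<mu> w + norm (f w) powr p * \<mu> w)"
      using w by (simp add: norm_mult distrib_right)
  qed
qed

text \<open>Integrating the kernel series term by term gives a power series in z with coefficients
  \<open>a n\<close>. As |w| < 1, the terms are dominated by those of the kernel series at z itself
  times |F'|, which justifies the exchange.\<close>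

lemma bergman_projection_holomorphic:
  assumes F: "integrable area (\<lambda>w. f w * of_real (\<mu> w))"
  shows "bergman_projection \<mu> f holomorphic_on disc"
proof -
  define F' where "F' w = f w * of_real (\<mu> w)" for w
  define a where "a n = of_real (kernel_coeff \<mu> n) * (LINT w|area. cnj w ^ n * F' w)" for n
  have F': "integrable area F'" using F by (simp add: F'_def[abs_def])
  then have [measurable]: "F' \<in> borel_measurable area" by auto
  have cnj_meas: "(\<lambda>w. cnj w ^ n) \<in> borel_measurable area" for n
    by (intro borel_imp_area_measurable borel_measurable_continuous_onI continuous_intros)
  have int: "integrable area (\<lambda>w. cnj w ^ n * F' w)" for n
  proof (rule Bochner_Integration.integrable_bound[OF F'])
    show "(\<lambda>w. cnj w ^ n * F' w) \<in> borel_measurable area"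
      by (intro borel_measurable_times cnj_meas) measurable
    show "AE w in area. norm (cnj w ^ n * F' w) \<le> norm (F' w)"
      by (rule AE_I2) (auto simp: norm_mult norm_power power_le_one mult_left_le_one_le)
  qed
  have "(\<lambda>n. a n * (z - 0) ^ n) sums bergman_projection \<mu> f z" if "z \<in> disc" for z
  proof -
    define t where "t n w = of_real (kernel_coeff \<mu> n) * z ^ n * (cnj w ^ n * F' w)" for n w
    have z: "norm z < 1" using that by simp
    have t_int: "integrable area (t n)" for n
      unfolding t_def by (intro integrable_mult_right int)
    have t_le: "norm (t n w) \<le> norm (of_real (kernel_coeff \<mu> n) * z ^ n) * norm (F' w)" if "w \<in> space area" for n w
      using that unfolding t_def norm_mult
      by (intro mult_left_mono mult_left_le_one_le) (auto simp: norm_power power_le_one)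
    have "(\<lambda>n. integral\<^sup>L area (t n)) sums (LINT w|area. (\<Sum>n. t n w))"
    proof (rule sums_integral[OF t_int])
      show "AE w in area. summable (\<lambda>n. norm (t n w))"
      proof (rule AE_I2)
        fix w assume w: "w \<in> space area"
        show "summable (\<lambda>n. norm (t n w))"
          by (rule summable_comparison_test'[OF summable_mult2[OF summable_kernel[OF z], of "norm (F' w)"], of 0])
            (use t_le[OF w] in simp)
      qed
      show "summable (\<lambda>n. LINT w|area. norm (t n w))"
      proof (rule summable_comparison_test'[OF summable_mult2[OF summable_kernel[OF z], of "LINT w|area. norm (F' w)"], of 0])
        fix n
        have "(LINT w|area. norm (t n w)) \<le> (LINT w|area. norm (of_real (kernel_coeff \<mu> n) * z ^ n) * norm (F' w))"
          by (intro integral_mono integrable_norm t_int integrable_mult_right F' t_le)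
        then show "norm (LINT w|area. norm (t n w))
          \<le> norm (of_real (kernel_coeff \<mu> n) * z ^ n) * (LINT w|area. norm (F' w))" by simp
      qed
    qed
    moreover have "integral\<^sup>L area (t n) = a n * (z - 0) ^ n" for n
      unfolding t_def a_def integral_mult_right_zero by simp
    moreover have "(LINT w|area. (\<Sum>n. t n w)) = bergman_projection \<mu> f z"
      unfolding bergman_projection_def bergman_kernel_def
    proof (intro Bochner_Integration.integral_cong refl)
      fix w assume "w \<in> space area"
      then have "norm (z * cnj w) < 1"
        using z mult_strict_mono'[of "norm z" 1 "norm w" 1] by (simp add: norm_mult)
      from suminf_mult2[OF summable_norm_cancel[OF summable_kernel[OF this]], of "F' w"]
      have "(\<Sum>n. of_real (kernel_coeff \<mu> n) * (z * cnj w) ^ n) * F' w = (\<Sum>n. t n w)"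
        by (simp add: t_def power_mult_distrib mult_ac)
      then show "(\<Sum>n. t n w) = (\<Sum>n. of_real (kernel_coeff \<mu> n) * (z * cnj w) ^ n) * f w * of_real (\<mu> w)"
        by (simp add: F'_def mult_ac)
    qed
    ultimately show ?thesis by simp
  qed
  then show ?thesis by (rule power_series_holomorphic)
qed

section \<open>Schur bounds for the weighted measure\<close>

text \<open>With the weight absorbed into the measure the majorant is a symmetric kernel, so both
  Schur conditions are one estimate at two exponents.\<close>

definition weight_measure :: "complex measure" where
  "weight_measure = density area (\<lambda>z. ennreal (\<mu> z))"

lemma space_weight_measure [simp]: "space weight_measure = disc"
  by (simp add: weight_measure_def)

lemma sets_weight_measure [measurable_cong, simp]: "sets weight_measure = sets area"
  by (simp add: weight_measure_def)

lemma nn_integral_weight_measure: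
  assumes [measurable]: "f \<in> borel_measurable area"
  shows "(\<integral>\<^sup>+z. f z \<partial>weight_measure) = (\<integral>\<^sup>+z. ennreal (\<mu> z) * f z \<partial>area)"
  unfolding weight_measure_def by (rule nn_integral_density) measurable

lemma finite_weight_measure: "finite_measure weight_measure"
proof (rule finite_measureI)
  have "emeasure weight_measure (space weight_measure) = (\<integral>\<^sup>+z. 1 \<partial>weight_measure)" by simp
  also have "\<dots> = (\<integral>\<^sup>+z. ennreal (\<mu> z) * 1 \<partial>area)"
    by (rule nn_integral_weight_measure) simp
  also have "\<dots> = (\<integral>\<^sup>+z. ennreal (norm (norm z ^ (2 * 0) * \<mu> z)) \<partial>area)"
    by (intro nn_integral_cong) (use weight_pos in \<open>simp add: less_imp_le\<close>)
  also have "\<dots> < \<infinity>" using integrable_weight_moment[of 0] by (simp add: integrable_iff_bounded)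
  finally show "emeasure weight_measure (space weight_measure) \<noteq> \<infinity>" by simp
qed

lemma kernel_majorant_area_measurable: "kernel_majorant \<alpha> z \<in> borel_measurable area"
proof (rule borel_imp_area_measurable)
  show "kernel_majorant \<alpha> z \<in> borel_measurable borel"
    unfolding kernel_majorant_def by measurable
qed

lemma nn_integral_weight_kernel_majorant:
  assumes s: "0 < s" "s < \<alpha> + 1"
  obtains C where "C > 0" and "\<And>z. norm z < 1 \<Longrightarrow>
    (\<integral>\<^sup>+w. ennreal (kernel_majorant \<alpha> z w) * ennreal ((1 - (norm w)\<^sup>2) powr (-s)) \<partial>weight_measure)
      \<le> ennreal (C * (1 - (norm z)\<^sup>2) powr (-s))"
proof -
  obtain C where C: "C > 0" "\<And>z. norm z < 1 \<Longrightarrow>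
    (\<integral>\<^sup>+w\<in>disc. ennreal ((1 - (norm w)\<^sup>2) powr (\<alpha> - s) * kernel_majorant \<alpha> z w) \<partial>lborel)
      \<le> ennreal (C * (1 - (norm z)\<^sup>2) powr (-s))"
    using nn_integral_kernel_majorant[OF \<alpha> s] by blast
  show thesis
  proof (rule that[of "K * C"])
    fix z :: complex assume z: "norm z < 1"
    have [measurable]: "kernel_majorant \<alpha> z \<in> borel_measurable area"
      "(\<lambda>w::complex. (1 - (norm w)\<^sup>2) powr (-s)) \<in> borel_measurable area"
      "(\<lambda>w::complex. (1 - (norm w)\<^sup>2) powr (\<alpha> - s)) \<in> borel_measurable area"
      by (rule kernel_majorant_area_measurable) (rule borel_imp_area_measurable, measurable)+
    have "(\<integral>\<^sup>+w. ennreal (kernel_majorant \<alpha> z w) * ennreal ((1 - (norm w)\<^sup>2) powr (-s)) \<partial>weight_measure)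
      = (\<integral>\<^sup>+w. ennreal (\<mu> w) * (ennreal (kernel_majorant \<alpha> z w) * ennreal ((1 - (norm w)\<^sup>2) powr (-s))) \<partial>area)"
      by (rule nn_integral_weight_measure) measurable
    also have "\<dots> \<le> (\<integral>\<^sup>+w. ennreal K * ennreal ((1 - (norm w)\<^sup>2) powr (\<alpha> - s) * kernel_majorant \<alpha> z w) \<partial>area)"
    proof (rule nn_integral_mono)
      fix w assume "w \<in> space area"
      then have w: "norm w < 1" by simp
      have "\<mu> w * (kernel_majorant \<alpha> z w * (1 - (norm w)\<^sup>2) powr (-s))
          \<le> (K * (1 - (norm w)\<^sup>2) powr \<alpha>) * (kernel_majorant \<alpha> z w * (1 - (norm w)\<^sup>2) powr (-s))"
        by (intro mult_right_mono weight_bounds(2)[OF w]) (simp add: kernel_majorant_nonneg)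
      also have "\<dots> = K * (((1 - (norm w)\<^sup>2) powr \<alpha> * (1 - (norm w)\<^sup>2) powr (-s)) * kernel_majorant \<alpha> z w)"
        by (simp add: mult_ac)
      also have "(1 - (norm w)\<^sup>2) powr \<alpha> * (1 - (norm w)\<^sup>2) powr (-s) = (1 - (norm w)\<^sup>2) powr (\<alpha> - s)"
        by (simp flip: powr_add)
      finally show "ennreal (\<mu> w) * (ennreal (kernel_majorant \<alpha> z w) * ennreal ((1 - (norm w)\<^sup>2) powr (-s)))
        \<le> ennreal K * ennreal ((1 - (norm w)\<^sup>2) powr (\<alpha> - s) * kernel_majorant \<alpha> z w)"
        using weight_pos[OF w] K_pos kernel_majorant_nonneg[of \<alpha> z w]
        by (auto simp flip: ennreal_mult intro!: ennreal_leI)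
    qed
    also have "\<dots> = ennreal K * (\<integral>\<^sup>+w. ennreal ((1 - (norm w)\<^sup>2) powr (\<alpha> - s) * kernel_majorant \<alpha> z w) \<partial>area)"
      by (rule nn_integral_cmult) measurable
    also have "\<dots> \<le> ennreal K * ennreal (C * (1 - (norm z)\<^sup>2) powr (-s))"
      unfolding nn_integral_area by (intro mult_left_mono C(2)[OF z]) auto
    also have "\<dots> = ennreal (K * C * (1 - (norm z)\<^sup>2) powr (-s))"
      using K_pos C(1) by (simp flip: ennreal_mult add: mult.assoc)
    finally show "(\<integral>\<^sup>+w. ennreal (kernel_majorant \<alpha> z w) * ennreal ((1 - (norm w)\<^sup>2) powr (-s)) \<partial>weight_measure)
      \<le> ennreal (K * C * (1 - (norm z)\<^sup>2) powr (-s))" .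
  qed (use K_pos C(1) in simp)
qed

lemma norm_bergman_projection_le:
  assumes F: "integrable area (\<lambda>w. f w * of_real (\<mu> w))" and f [measurable]: "f \<in> borel_measurable area"
    and z: "norm z < 1"
  shows "ennreal (norm (bergman_projection \<mu> f z))
    \<le> (\<integral>\<^sup>+w. ennreal ((c0 + c1) * kernel_majorant \<alpha> z w) * ennreal (norm (f w)) \<partial>weight_measure)"
proof -
  have [measurable]: "kernel_majorant \<alpha> z \<in> borel_measurable area" by (rule kernel_majorant_area_measurable)
  have "ennreal (norm (bergman_projection \<mu> f z))
      \<le> (\<integral>\<^sup>+w. ennreal (norm (bergman_kernel \<mu> z w * f w * of_real (\<mu> w))) \<partial>area)"
  \<comment> \<open>A non-integrable integrand has Bochner integral 0, and the bound is then
    trivial.\<close>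
  proof (cases "integrable area (\<lambda>w. bergman_kernel \<mu> z w * f w * of_real (\<mu> w))")
    case True
    then show ?thesis unfolding bergman_projection_def by (rule integral_norm_bound_ennreal)
  qed (simp add: bergman_projection_def not_integrable_integral_eq)
  also have "\<dots> \<le> (\<integral>\<^sup>+w. ennreal (\<mu> w) * (ennreal ((c0 + c1) * kernel_majorant \<alpha> z w) * ennreal (norm (f w))) \<partial>area)"
  proof (rule nn_integral_mono)
    fix w assume "w \<in> space area"
    then have w: "norm w < 1" by simp
    have "norm (bergman_kernel \<mu> z w * f w * of_real (\<mu> w)) = norm (bergman_kernel \<mu> z w) * (norm (f w) * \<mu> w)"
      using weight_pos[OF w] by (simp add: norm_mult)
    also have "\<dots> \<le> ((c0 + c1) * kernel_majorant \<alpha> z w) * (norm (f w) * \<mu> w)"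
      using weight_pos[OF w] by (intro mult_right_mono norm_bergman_kernel_le z w) auto
    also have "\<dots> = \<mu> w * ((c0 + c1) * kernel_majorant \<alpha> z w * norm (f w))" by (simp add: mult_ac)
    finally show "ennreal (norm (bergman_kernel \<mu> z w * f w * of_real (\<mu> w)))
       \<le> ennreal (\<mu> w) * (ennreal ((c0 + c1) * kernel_majorant \<alpha> z w) * ennreal (norm (f w)))"
      using weight_pos[OF w] c0_pos c1_nonneg kernel_majorant_nonneg[of \<alpha> z w]
      by (auto simp flip: ennreal_mult intro!: ennreal_leI)
  qed
  also have "\<dots> = (\<integral>\<^sup>+w. ennreal ((c0 + c1) * kernel_majorant \<alpha> z w) * ennreal (norm (f w)) \<partial>weight_measure)"
    by (rule nn_integral_weight_measure[symmetric]) measurable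
  finally show ?thesis .
qed

lemma bergman_projection_nn_bounded:
  assumes p: "p > 1"
  obtains C where "C > 0" and "\<And>f. f \<in> Lp p \<mu> \<Longrightarrow>
    (\<integral>\<^sup>+z. ennreal (norm (bergman_projection \<mu> f z) powr p) \<partial>weight_measure)
      \<le> ennreal (C powr p) * (\<integral>\<^sup>+z. ennreal (norm (f z) powr p) \<partial>weight_measure)"
proof -
  define q where "q = p / (p - 1)"
  have pq: "p > 1" "q > 1" "1 / p + 1 / q = 1" using p by (auto simp: q_def field_simps)
  \<comment> \<open>One symmetric choice puts both s p and s q strictly between 0 and \<alpha> +
    1.\<close>
  define s where "s = (\<alpha> + 1) / (p + q)"
  have s: "s > 0" "s * p < \<alpha> + 1" "s * q < \<alpha> + 1"
  proof -
    have "p / (p + q) < 1" "q / (p + q) < 1" using pq by (auto simp: field_simps)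
    from this[THEN mult_strict_left_mono, of "\<alpha> + 1"] \<alpha> pq
    show "s > 0" "s * p < \<alpha> + 1" "s * q < \<alpha> + 1" by (simp_all add: s_def)
  qed
  define h where "h z = (1 - (norm z)\<^sup>2) powr (-s)" for z :: complex
  have h_powr: "h z powr r = (1 - (norm z)\<^sup>2) powr (-(s * r))" for z r
    by (simp add: h_def powr_powr)
  have [measurable]: "h \<in> borel_measurable area"
    unfolding h_def by (rule borel_imp_area_measurable) measurable
  have sp: "0 < s * p" "0 < s * q" using s pq by simp_all
  obtain Cp where Cp: "Cp > 0"
    "\<And>z. norm z < 1 \<Longrightarrow> (\<integral>\<^sup>+w. ennreal (kernel_majorant \<alpha> z w) * ennreal (h w powr p) \<partial>weight_measure)
      \<le> ennreal (Cp * h z powr p)"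
    unfolding h_powr using nn_integral_weight_kernel_majorant[OF sp(1) s(2)] by blast
  obtain Cq where Cq: "Cq > 0"
    "\<And>z. norm z < 1 \<Longrightarrow> (\<integral>\<^sup>+w. ennreal (kernel_majorant \<alpha> z w) * ennreal (h w powr q) \<partial>weight_measure)
      \<le> ennreal (Cq * h z powr q)"
    unfolding h_powr using nn_integral_weight_kernel_majorant[OF sp(2) s(3)] by blast
  define c where "c = c0 + c1"
  have c: "c > 0" using c0_pos c1_nonneg by (simp add: c_def)
  \<comment> \<open>The sum dominates both constants, since the Schur test takes a single
    one.\<close>
  define C where "C = c * (Cp + Cq)"
  have scale: "(\<integral>\<^sup>+w. ennreal (c * kernel_majorant \<alpha> z w) * ennreal (h w powr r) \<partial>weight_measure)
      \<le> ennreal (C * h z powr r)"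
    if D: "(\<integral>\<^sup>+w. ennreal (kernel_majorant \<alpha> z w) * ennreal (h w powr r) \<partial>weight_measure) \<le> ennreal (D * h z powr r)"
      and "D > 0" "D \<le> Cp + Cq" for z r D
  proof -
    have [measurable]: "kernel_majorant \<alpha> z \<in> borel_measurable area" by (rule kernel_majorant_area_measurable)
    have "(\<integral>\<^sup>+w. ennreal (c * kernel_majorant \<alpha> z w) * ennreal (h w powr r) \<partial>weight_measure)
      = ennreal c * (\<integral>\<^sup>+w. ennreal (kernel_majorant \<alpha> z w) * ennreal (h w powr r) \<partial>weight_measure)"
      using c kernel_majorant_nonneg[of \<alpha> z]
      by (subst nn_integral_cmult[symmetric]) (auto simp: ennreal_mult mult.assoc)
    also have "\<dots> \<le> ennreal c * ennreal (D * h z powr r)" by (intro mult_left_mono D) auto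
    also have "\<dots> = ennreal (c * D * h z powr r)"
      using c \<open>D > 0\<close> by (simp flip: ennreal_mult add: mult.assoc)
    also have "\<dots> \<le> ennreal (C * h z powr r)"
      unfolding C_def using c that by (intro ennreal_leI mult_right_mono mult_left_mono) auto
    finally show ?thesis .
  qed
  \<comment> \<open>The majorant is Borel in both variables; composing the projections with this
    identity map gives joint measurability on the product.\<close>
  have id [measurable]: "(\<lambda>x. x) \<in> weight_measure \<rightarrow>\<^sub>M borel"
    using borel_imp_area_measurable[of "\<lambda>x. x"] by simp
  have meas: "(\<lambda>(z, w). ennreal (c * kernel_majorant \<alpha> z w)) \<in> borel_measurable (weight_measure \<Otimes>\<^sub>M weight_measure)"
  proof -
    note [measurable] = measurable_compose[OF measurable_fst id] measurable_compose[OF measurable_snd id]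
    show ?thesis unfolding kernel_majorant_def split_beta by measurable
  qed
  interpret finite_measure weight_measure by (rule finite_weight_measure)
  show thesis
  proof (rule that[of C])
    show "C > 0" using c Cp Cq by (simp add: C_def)
    fix f assume f: "f \<in> Lp p \<mu>"
    then have [measurable]: "f \<in> borel_measurable area" by (simp add: Lp_def)
    show "(\<integral>\<^sup>+z. ennreal (norm (bergman_projection \<mu> f z) powr p) \<partial>weight_measure)
      \<le> ennreal (C powr p) * (\<integral>\<^sup>+z. ennreal (norm (f z) powr p) \<partial>weight_measure)"
    proof (rule Schur_test[OF _ pq \<open>C > 0\<close> meas, of h])
      show "sigma_finite_measure weight_measure" by unfold_locales
      fix z assume "z \<in> space weight_measure"
      then have z: "norm z < 1" by simp
      then have "(norm z)\<^sup>2 < 1" by (simp add: abs_square_less_1)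
      then show "h z > 0" by (simp add: h_def)
      show "(\<integral>\<^sup>+w. ennreal (c * kernel_majorant \<alpha> z w) * ennreal (h w powr q) \<partial>weight_measure) \<le> ennreal (C * h z powr q)"
        by (rule scale[OF Cq(2)[OF z]]) (use Cp Cq in auto)
      show "(\<integral>\<^sup>+w. ennreal (c * kernel_majorant \<alpha> w z) * ennreal (h w powr p) \<partial>weight_measure) \<le> ennreal (C * h z powr p)"
        unfolding kernel_majorant_commute[of \<alpha> _ z] by (rule scale[OF Cp(2)[OF z]]) (use Cp Cq in auto)
      show "ennreal (norm (bergman_projection \<mu> f z))
        \<le> (\<integral>\<^sup>+w. ennreal (c * kernel_majorant \<alpha> z w) * ennreal (norm (f w)) \<partial>weight_measure)"
        unfolding c_def by (rule norm_bergman_projection_le[OF Lp_integrable[OF p f] _ z]) measurable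
    qed measurable
  qed
qed

lemma nn_integral_weight_Lp:
  assumes [measurable]: "f \<in> borel_measurable area"
  shows "(\<integral>\<^sup>+z. ennreal (norm (f z) powr p) \<partial>weight_measure)
      = (\<integral>\<^sup>+z. ennreal (norm (f z) powr p * \<mu> z) \<partial>area)"
  by (subst nn_integral_weight_measure)
    (auto intro!: nn_integral_cong simp: ennreal_mult weight_pos less_imp_le mult.commute)

lemma bergman_projection_bounded:
  assumes p: "p > 1"
  obtains C where "C > 0" and "\<And>f. f \<in> Lp p \<mu> \<Longrightarrow> bergman_projection \<mu> f \<in> Ap p \<mu> \<and>
    Lp_norm p \<mu> (bergman_projection \<mu> f) \<le> C * Lp_norm p \<mu> f"
proof -
  obtain C where C: "C > 0" "\<And>f. f \<in> Lp p \<mu> \<Longrightarrow>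
    (\<integral>\<^sup>+z. ennreal (norm (bergman_projection \<mu> f z) powr p) \<partial>weight_measure)
      \<le> ennreal (C powr p) * (\<integral>\<^sup>+z. ennreal (norm (f z) powr p) \<partial>weight_measure)"
    using bergman_projection_nn_bounded[OF p] by blast
  have "bergman_projection \<mu> f \<in> Ap p \<mu> \<and> Lp_norm p \<mu> (bergman_projection \<mu> f) \<le> C * Lp_norm p \<mu> f"
    if f: "f \<in> Lp p \<mu>" for f
  proof -
    define P where "P = bergman_projection \<mu> f"
    have [measurable]: "f \<in> borel_measurable area" and i: "integrable area (\<lambda>z. norm (f z) powr p * \<mu> z)"
      using f by (auto simp: Lp_def)
    have hol: "P holomorphic_on disc"
      unfolding P_def by (rule bergman_projection_holomorphic[OF Lp_integrable[OF p f]])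
    then have [measurable]: "P \<in> borel_measurable area"
      by (intro continuous_imp_measurable_on_sets_lebesgue holomorphic_on_imp_continuous_on) simp_all
    have nonneg: "AE z in area. 0 \<le> norm (u z) powr p * \<mu> z" for u :: "complex \<Rightarrow> complex"
      using weight_pos by (intro AE_I2) (simp add: less_imp_le)
    define I where "I = (LINT z|area. norm (f z) powr p * \<mu> z)"
    have I: "I \<ge> 0" unfolding I_def by (rule integral_nonneg_AE[OF nonneg])
    have "(\<integral>\<^sup>+z. ennreal (norm (P z) powr p * \<mu> z) \<partial>area)
        \<le> ennreal (C powr p) * (\<integral>\<^sup>+z. ennreal (norm (f z) powr p * \<mu> z) \<partial>area)"
      using C(2)[OF f] by (simp add: P_def[symmetric] nn_integral_weight_Lp)
    also have "(\<integral>\<^sup>+z. ennreal (norm (f z) powr p * \<mu> z) \<partial>area) = ennreal I"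
      unfolding I_def by (rule nn_integral_eq_integral[OF i nonneg])
    finally have le: "(\<integral>\<^sup>+z. ennreal (norm (P z) powr p * \<mu> z) \<partial>area) \<le> ennreal (C powr p * I)"
      using I by (simp add: ennreal_mult)
    \<comment> \<open>Integrability must precede the norm comparison: without it the Bochner
      integral would be 0 by convention and the bound would say nothing.\<close>
    then have iP: "integrable area (\<lambda>z. norm (P z) powr p * \<mu> z)"
      by (intro integrableI_nonneg nonneg) (auto intro: le_less_trans)
    then have "P \<in> Ap p \<mu>" using hol by (simp add: Ap_def Lp_def)
    moreover have "Lp_norm p \<mu> P \<le> C * Lp_norm p \<mu> f"
    proof -
      have "(LINT z|area. norm (P z) powr p * \<mu> z) \<le> C powr p * I"
        using le I unfolding nn_integral_eq_integral[OF iP nonneg] by (simp add: ennreal_le_iff)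
      then have "Lp_norm p \<mu> P \<le> (C powr p * I) powr (1 / p)"
        unfolding Lp_norm_def using p by (intro powr_mono2 integral_nonneg_AE nonneg) auto
      also have "\<dots> = C * I powr (1 / p)" using C(1) I p by (simp add: powr_mult powr_powr)
      finally show ?thesis by (simp add: Lp_norm_def I_def)
    qed
    ultimately show ?thesis by (simp add: P_def)
  qed
  then show thesis using that C(1) by blast
qed

end

theorem theorem1p2:
  fixes \<alpha> :: real and M :: "real \<Rightarrow> real" and \<mu> :: "complex \<Rightarrow> real"
  assumes "\<alpha> > -1"
    and "\<And>r. r \<in> {0..1} \<Longrightarrow> M r > 0"
    and "C2_on {0..1} M"
    and "\<mu> = radial_weight M \<alpha>"
  shows "\<forall>p>1. \<exists>C>0. \<forall>f\<in>Lp p \<mu>.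
           bergman_projection \<mu> f \<in> Ap p \<mu> \<and>
           Lp_norm p \<mu> (bergman_projection \<mu> f) \<le> C * Lp_norm p \<mu> f"
proof (intro allI impI)
  fix p :: real assume p: "p > 1"
  obtain m K L where "comparable_weight \<alpha> M m K L"
    using C2_on_imp_bounds[OF assms(3,2)] assms(1) unfolding comparable_weight_def by metis
  then interpret W: comparable_weight \<alpha> M m K L .
  have "\<mu> = W.\<mu>" by (simp add: W.\<mu>_def assms(4))
  then show "\<exists>C>0. \<forall>f\<in>Lp p \<mu>. bergman_projection \<mu> f \<in> Ap p \<mu> \<and>
      Lp_norm p \<mu> (bergman_projection \<mu> f) \<le> C * Lp_norm p \<mu> f"
    using W.bergman_projection_bounded[OF p] by metis
qed

end
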